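(* Let $k\ge1$, $J>0$, $\beta>0$ and write $\theta=\exp(\beta J/2)$. Consider the triple mixed-spin Ising model with spin values $(\tfrac12,1,\tfrac32)$ on the Cayley tree $\Gamma^k$ of order $k$, and let $\mu_0$ be the translation-invariant splitting Gibbs measure corresponding to the fixed point $x_0=1$ of the scalar recursion (the disordered phase), i.e. to the constant solution $$X_0=U_0=1,\qquad N_0=T_0=\Big(\frac{1+\theta^3}{\theta^2+\theta}\Big)^k,\qquad Y_0=Z_0=\Big(\frac{\theta^6T_0+\theta^4+\theta^2+T_0}{2\theta^3(T_0+1)}\Big)^k .$$ Let $H=H(\theta,k)=\mathcal P\mathcal Q\mathcal R$ be the $2\times2$ stochastic matrix (the effective transition matrix from $\Psi$ to $\Psi$) defined in the context, evaluated at this solution, and let $\lambda_{0,k}$ be its second eigenvalue in absolute value (i.e. the eigenvalue other than the trivial eigenvalue $1$). If $$k^3\lambda_{0,k}^2>1,$$ then the Gibbs measure $\mu_0$ is non-extremal.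
   Context: Tree. $\Gamma^k=(V,L)$ is the semi-infinite Cayley tree of order $k$: an infinite tree with root $x^{(0)}$ in which the root has exactly $k$ edges and every other vertex has exactly $k+1$ edges. $d$ is graph distance, $W_n=\{x: d(x,x^{(0)})=n\}$, $V_n=\bigcup_{m=0}^n W_m$, $L_n$ is the set of edges with both endpoints in $V_n$, and $\Gamma_i^k=\{x\in V: d(x^{(0)},x)\equiv i \pmod 3\}$ for $i=0,1,2$. Model. $\Psi=\{-\tfrac12,\tfrac12\}$, $\Phi=\{-1,0,1\}$, $\Upsilon=\{-\tfrac32,-\tfrac12,\tfrac12,\tfrac32\}$. The spin set $S_x$ of a vertex $x$ is $\Psi$, $\Phi$ or $\Upsilon$ according to whether $x\in\Gamma_0^k$, $\Gamma_1^k$ or $\Gamma_2^k$. Configurations are $\xi\in\Xi=\prod_{x\in V}S_x$, and $\Xi_n=\prod_{x\in V_n}S_x$. The Hamiltonian is $H(\xi)=-J\sum_{\langle x,y\rangle\in L}\xi(x)\xi(y)$, and $H_n(\xi)=-J\sum_{\langle x,y\rangle\in L_n}\xi(x)\xi(y)$ for $\xi\in\Xi_n$. (The matrix $H(\theta,k)$ is unrelated to the Hamiltonian.) Gibbs measures. A Gibbs measure is a probability measure on $\Xi$ satisfying the DLR equations for this nearest-neighbour Hamiltonian at inverse temperature $\beta$. A Gibbs measure is extremal if it cannot be represented as a non-trivial convex combination of other Gibbs measures; otherwise it is non-extremal. Splitting Gibbs measures. Given a family of real vectors $h_x=(h_{s,x})_{s\in S_x}$, $x\in V$, define for $n\ge1$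 the probability measure on $\Xi_n$ $$\mu_n^h(\xi)=\frac1{Z_n}\exp\Big\{-\beta H_n(\xi)+\sum_{x\in W_n}h_{\xi(x),x}\Big\}.$$ The sequence is compatible if $\sum_{\omega\in\prod_{x\in W_n}S_x}\mu_n^h(\xi_{n-1}\vee\omega)=\mu_{n-1}^h(\xi_{n-1})$ for all $n\ge1$ and $\xi_{n-1}\in\Xi_{n-1}$ ($\vee$ denotes concatenation). Then there is a unique probability measure $\mu$ on $\Xi$ whose marginal on each $V_n$ is $\mu_n^h$; it is called a splitting Gibbs measure (SGM). Put $X_x=e^{h_{1/2,x}-h_{-1/2,x}}$ for $x\in\Gamma_0^k$; $Y_x=e^{h_{-1,x}-h_{0,x}}$, $Z_x=e^{h_{1,x}-h_{0,x}}$ for $x\in\Gamma_1^k$; $T_x=e^{h_{-3/2,x}-h_{-1/2,x}}$, $U_x=e^{h_{1/2,x}-h_{-1/2,x}}$, $N_x=e^{h_{3/2,x}-h_{-1/2,x}}$ for $x\in\Gamma_2^k$. An SGM is translation-invariant if it comes from a compatible family $h$ for which these quantities are constants $X,Y,Z,T,U,N>0$ not depending on $x$; by the standard compatibility criterion such constants are exactly the positive solutions of $$X=\Big(\tfrac{Y+\theta+\theta^2Z}{\theta^2Y+\theta+Z}\Big)^k,\quad Y=\Big(\tfrac{\theta^6T+\theta^4+\theta^2U+N}{\theta^3(T+1+U+N)}\Big)^k,\quad Z=\Big(\tfrac{T+\theta^2+\theta^4U+\theta^6N}{\theta^3(T+1+U+N)}\Big)^k,$$ $$T=\Big(\tfrac{X+\theta^3}{\theta^2+\theta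 X}\Big)^k,\quad U=\Big(\tfrac{\theta X+1}{X+\theta}\Big)^k,\quad N=\Big(\tfrac{\theta^3X+1}{\theta^2+\theta X}\Big)^k.$$ Eliminating all variables but $x=X^{1/k}$ reduces this system to a scalar fixed-point equation in $x>0$, of which $x_0=1$ is a solution; $\mu_0$ is the measure given by the corresponding constants $X_0,Y_0,Z_0,T_0,U_0,N_0$. Transition matrices (rows and columns indexed by spins in increasing order), for constants $X,Y,Z,T,U,N$: $\mathcal P$ is the $2\times3$ stochastic matrix indexed by $\Psi\times\Phi$ with rows proportional to $(\theta^2Y,\ \theta,\ Z)$ and $(Y,\ \theta,\ \theta^2Z)$; $\mathcal Q$ is the $3\times4$ stochastic matrix indexed by $\Phi\times\Upsilon$ with rows proportional to $(\theta^6T,\ \theta^4,\ \theta^2U,\ N)$, $(T,\ 1,\ U,\ N)$ and $(T,\ \theta^2,\ \theta^4U,\ \theta^6N)$; $\mathcal R$ is the $4\times2$ stochastic matrix indexed by $\Upsilon\times\Psi$ with rows proportional to $(\theta^3,\ X)$, $(\theta,\ X)$, $(1,\ \theta X)$, $(1,\ \theta^3X)$. Each row is normalized to sum to $1$. These are the parent-to-child transition matrices of the tree-indexed Markov chain given by the translation-invariant splitting Gibbs measure, and $H=\mathcal P\mathcal Q\mathcal R$. *)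

theory Defs
  imports "HOL-Probability.Probability" "Jordan_Normal_Form.Char_Poly"
begin

section \<open>The semi-infinite Cayley tree\<close>

text \<open>Simple graphs with a distinguished vertex; an edge is an unordered pair of distinct vertices.\<close>

record 'v rooted_graph =
  verts :: "'v set"
  edges :: "'v set set"
  origin :: 'v

definition simple_rooted_graph :: "'v rooted_graph \<Rightarrow> bool" where
  "simple_rooted_graph G \<longleftrightarrow>
     origin G \<in> verts G \<and> (\<forall>e\<in>edges G. e \<subseteq> verts G \<and> card e = 2)"

definition walk_betw :: "'v rooted_graph \<Rightarrow> 'v \<Rightarrow> 'v list \<Rightarrow> 'v \<Rightarrow> bool" where
  "walk_betw G x xs y \<longleftrightarrow>
     xs \<noteq> [] \<and> hd xs = x \<and> last xs = y \<and> set xs \<subseteq> verts G \<and>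
     successively (\<lambda>u v. {u, v} \<in> edges G) xs"

definition path_betw :: "'v rooted_graph \<Rightarrow> 'v \<Rightarrow> 'v list \<Rightarrow> 'v \<Rightarrow> bool" where
  "path_betw G x xs y \<longleftrightarrow> walk_betw G x xs y \<and> distinct xs"

definition is_tree :: "'v rooted_graph \<Rightarrow> bool" where
  "is_tree G \<longleftrightarrow> simple_rooted_graph G \<and> (\<forall>x\<in>verts G. \<forall>y\<in>verts G. \<exists>!xs. path_betw G x xs y)"

definition vertex_degree :: "'v rooted_graph \<Rightarrow> 'v \<Rightarrow> nat" where
  "vertex_degree G x = card {e \<in> edges G. x \<in> e}"

text \<open>For \<open>k \<ge> 1\<close> all degrees below are nonzero, so the convention that infinite sets have
  cardinality 0 is harmless and the graph is locally finite.\<close>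

definition semi_infinite_cayley_tree :: "nat \<Rightarrow> 'v rooted_graph \<Rightarrow> bool" where
  "semi_infinite_cayley_tree k G \<longleftrightarrow>
     is_tree G \<and> infinite (verts G) \<and>
     (\<forall>x\<in>verts G. vertex_degree G x = (if x = origin G then k else k + 1))"

text \<open>Walks are lists of vertices, so a walk with \<open>n\<close> edges has length \<open>n + 1\<close>.\<close>

definition graph_dist :: "'v rooted_graph \<Rightarrow> 'v \<Rightarrow> 'v \<Rightarrow> nat" where
  "graph_dist G x y = (LEAST n. \<exists>xs. walk_betw G x xs y \<and> length xs = Suc n)"

definition level :: "'v rooted_graph \<Rightarrow> nat \<Rightarrow> 'v set" where
  "level G n = {x \<in> verts G. graph_dist G x (origin G) = n}"

definition tree_ball :: "'v rooted_graph \<Rightarrow> nat \<Rightarrow> 'v set" where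
  "tree_ball G n = (\<Union>m\<le>n. level G m)"

definition ball_edges :: "'v rooted_graph \<Rightarrow> nat \<Rightarrow> 'v set set" where
  "ball_edges G n = {e \<in> edges G. e \<subseteq> tree_ball G n}"

definition vertex_class :: "'v rooted_graph \<Rightarrow> nat \<Rightarrow> 'v set" where
  "vertex_class G i = {x \<in> verts G. graph_dist G (origin G) x mod 3 = i}"

section \<open>The triple mixed-spin Ising model\<close>

definition Psi_spins :: "real set" where "Psi_spins = {-1/2, 1/2}"
definition Phi_spins :: "real set" where "Phi_spins = {-1, 0, 1}"
definition Upsilon_spins :: "real set" where "Upsilon_spins = {-3/2, -1/2, 1/2, 3/2}"

definition spin_set :: "'v rooted_graph \<Rightarrow> 'v \<Rightarrow> real set" where
  "spin_set G x =
     (if x \<in> vertex_class G 0 then Psi_spins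
      else if x \<in> vertex_class G 1 then Phi_spins
      else Upsilon_spins)"

definition configs_on :: "'v rooted_graph \<Rightarrow> 'v set \<Rightarrow> ('v \<Rightarrow> real) set" where
  "configs_on G A = (\<Pi>\<^sub>E x\<in>A. spin_set G x)"

definition config_space :: "'v rooted_graph \<Rightarrow> ('v \<Rightarrow> real) measure" where
  "config_space G = (\<Pi>\<^sub>M x\<in>verts G. count_space (spin_set G x))"

text \<open>Energy of a finite set of edges; for an edge \<open>{x, y}\<close> the product is \<open>\<xi> x * \<xi> y\<close>.\<close>

definition energy :: "real \<Rightarrow> 'v set set \<Rightarrow> ('v \<Rightarrow> real) \<Rightarrow> real" where
  "energy J E \<xi> = - J * (\<Sum>e\<in>E. \<Prod>x\<in>e. \<xi> x)"

section \<open>Gibbs measures\<close>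

text \<open>The finite-volume Gibbs kernel in \<open>\<Lambda>\<close> with boundary condition \<open>\<eta>\<close>. Only the edges meeting
  \<open>\<Lambda>\<close> enter: all other terms of the Hamiltonian cancel.\<close>

definition gibbs_weight ::
  "'v rooted_graph \<Rightarrow> real \<Rightarrow> real \<Rightarrow> 'v set \<Rightarrow> ('v \<Rightarrow> real) \<Rightarrow> real" where
  "gibbs_weight G J \<beta> \<Lambda> \<xi> = exp (- \<beta> * energy J {e \<in> edges G. e \<inter> \<Lambda> \<noteq> {}} \<xi>)"

definition gibbs_kernel ::
  "'v rooted_graph \<Rightarrow> real \<Rightarrow> real \<Rightarrow> 'v set \<Rightarrow> ('v \<Rightarrow> real) \<Rightarrow> ('v \<Rightarrow> real) set \<Rightarrow> real" where
  "gibbs_kernel G J \<beta> \<Lambda> \<eta> A =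
     (let glue = (\<lambda>\<sigma>. merge \<Lambda> (verts G - \<Lambda>) (\<sigma>, \<eta>)) in
      (\<Sum>\<sigma>\<in>configs_on G \<Lambda>. gibbs_weight G J \<beta> \<Lambda> (glue \<sigma>) * indicator A (glue \<sigma>)) /
      (\<Sum>\<sigma>\<in>configs_on G \<Lambda>. gibbs_weight G J \<beta> \<Lambda> (glue \<sigma>)))"

definition gibbs_measure ::
  "'v rooted_graph \<Rightarrow> real \<Rightarrow> real \<Rightarrow> ('v \<Rightarrow> real) measure \<Rightarrow> bool" where
  "gibbs_measure G J \<beta> \<mu> \<longleftrightarrow>
     prob_space \<mu> \<and> sets \<mu> = sets (config_space G) \<and>
     (\<forall>\<Lambda>. finite \<Lambda> \<and> \<Lambda> \<subseteq> verts G \<longrightarrow>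
        (\<forall>A\<in>sets \<mu>. measure \<mu> A = (\<integral>\<eta>. gibbs_kernel G J \<beta> \<Lambda> \<eta> A \<partial>\<mu>)))"

definition nontrivial_gibbs_mixture ::
  "'v rooted_graph \<Rightarrow> real \<Rightarrow> real \<Rightarrow> ('v \<Rightarrow> real) measure \<Rightarrow> bool" where
  "nontrivial_gibbs_mixture G J \<beta> \<mu> \<longleftrightarrow>
     (\<exists>\<mu>1 \<mu>2 t. gibbs_measure G J \<beta> \<mu>1 \<and> gibbs_measure G J \<beta> \<mu>2 \<and>
        \<mu>1 \<noteq> \<mu> \<and> \<mu>2 \<noteq> \<mu> \<and> 0 < t \<and> t < 1 \<and>
        (\<forall>A\<in>sets \<mu>. measure \<mu> A = t * measure \<mu>1 A + (1 - t) * measure \<mu>2 A))"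

definition extremal_gibbs ::
  "'v rooted_graph \<Rightarrow> real \<Rightarrow> real \<Rightarrow> ('v \<Rightarrow> real) measure \<Rightarrow> bool" where
  "extremal_gibbs G J \<beta> \<mu> \<longleftrightarrow> gibbs_measure G J \<beta> \<mu> \<and> \<not> nontrivial_gibbs_mixture G J \<beta> \<mu>"

definition non_extremal_gibbs ::
  "'v rooted_graph \<Rightarrow> real \<Rightarrow> real \<Rightarrow> ('v \<Rightarrow> real) measure \<Rightarrow> bool" where
  "non_extremal_gibbs G J \<beta> \<mu> \<longleftrightarrow> gibbs_measure G J \<beta> \<mu> \<and> \<not> extremal_gibbs G J \<beta> \<mu>"

section \<open>Splitting Gibbs measures\<close>

text \<open>A boundary field is a function \<open>h\<close> of a vertex \<open>x\<close> and a spin; only the values \<open>h x s\<close> with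
  \<open>s \<in> spin_set G x\<close> are used.\<close>

definition sgm_weight ::
  "'v rooted_graph \<Rightarrow> real \<Rightarrow> real \<Rightarrow> ('v \<Rightarrow> real \<Rightarrow> real) \<Rightarrow> nat \<Rightarrow> ('v \<Rightarrow> real) \<Rightarrow> real" where
  "sgm_weight G J \<beta> h n \<xi> =
     exp (- \<beta> * energy J (ball_edges G n) \<xi> + (\<Sum>x\<in>level G n. h x (\<xi> x)))"

definition sgm_mass ::
  "'v rooted_graph \<Rightarrow> real \<Rightarrow> real \<Rightarrow> ('v \<Rightarrow> real \<Rightarrow> real) \<Rightarrow> nat \<Rightarrow> ('v \<Rightarrow> real) \<Rightarrow> real" where
  "sgm_mass G J \<beta> h n \<xi> =
     sgm_weight G J \<beta> h n \<xi> / (\<Sum>\<zeta>\<in>configs_on G (tree_ball G n). sgm_weight G J \<beta> h n \<zeta>)"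

definition compatible_family ::
  "'v rooted_graph \<Rightarrow> real \<Rightarrow> real \<Rightarrow> ('v \<Rightarrow> real \<Rightarrow> real) \<Rightarrow> bool" where
  "compatible_family G J \<beta> h \<longleftrightarrow>
     (\<forall>n\<ge>1. \<forall>\<xi>\<in>configs_on G (tree_ball G (n - 1)).
        (\<Sum>\<omega>\<in>configs_on G (level G n).
           sgm_mass G J \<beta> h n (merge (tree_ball G (n - 1)) (level G n) (\<xi>, \<omega>)))
        = sgm_mass G J \<beta> h (n - 1) \<xi>)"

definition splitting_gibbs_measure ::
  "'v rooted_graph \<Rightarrow> real \<Rightarrow> real \<Rightarrow> ('v \<Rightarrow> real \<Rightarrow> real) \<Rightarrow> ('v \<Rightarrow> real) measure \<Rightarrow> bool" where
  "splitting_gibbs_measure G J \<beta> h \<mu> \<longleftrightarrow>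
     compatible_family G J \<beta> h \<and> prob_space \<mu> \<and> sets \<mu> = sets (config_space G) \<and>
     (\<forall>n. \<forall>\<xi>\<in>configs_on G (tree_ball G n).
        measure \<mu> {\<sigma> \<in> space \<mu>. restrict \<sigma> (tree_ball G n) = \<xi>} = sgm_mass G J \<beta> h n \<xi>)"

definition has_constant_ratios ::
  "'v rooted_graph \<Rightarrow> ('v \<Rightarrow> real \<Rightarrow> real) \<Rightarrow>
    real \<Rightarrow> real \<Rightarrow> real \<Rightarrow> real \<Rightarrow> real \<Rightarrow> real \<Rightarrow> bool" where
  "has_constant_ratios G h X Y Z T U N \<longleftrightarrow>
     (\<forall>x\<in>vertex_class G 0. exp (h x (1/2) - h x (-1/2)) = X) \<and>
     (\<forall>x\<in>vertex_class G 1. exp (h x (-1) - h x 0) = Y \<and> exp (h x 1 - h x 0) = Z) \<and>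
     (\<forall>x\<in>vertex_class G 2. exp (h x (-3/2) - h x (-1/2)) = T \<and>
        exp (h x (1/2) - h x (-1/2)) = U \<and> exp (h x (3/2) - h x (-1/2)) = N)"

definition translation_invariant_sgm ::
  "'v rooted_graph \<Rightarrow> real \<Rightarrow> real \<Rightarrow>
    real \<Rightarrow> real \<Rightarrow> real \<Rightarrow> real \<Rightarrow> real \<Rightarrow> real \<Rightarrow> ('v \<Rightarrow> real) measure \<Rightarrow> bool" where
  "translation_invariant_sgm G J \<beta> X Y Z T U N \<mu> \<longleftrightarrow>
     (\<exists>h. has_constant_ratios G h X Y Z T U N \<and> splitting_gibbs_measure G J \<beta> h \<mu>)"

section \<open>Transition matrices\<close>

text \<open>Rows and columns are indexed by the spins in increasing order.\<close>

definition normalize_rows :: "real mat \<Rightarrow> real mat" where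
  "normalize_rows A =
     mat (dim_row A) (dim_col A) (\<lambda>(i, j). A $$ (i, j) / (\<Sum>l<dim_col A. A $$ (i, l)))"

definition P_matrix :: "real \<Rightarrow> real \<Rightarrow> real \<Rightarrow> real mat" where
  "P_matrix \<theta> Y Z = normalize_rows (mat_of_rows_list 3
     [[\<theta>^2 * Y, \<theta>, Z],
      [Y, \<theta>, \<theta>^2 * Z]])"

definition Q_matrix :: "real \<Rightarrow> real \<Rightarrow> real \<Rightarrow> real \<Rightarrow> real mat" where
  "Q_matrix \<theta> T U N = normalize_rows (mat_of_rows_list 4
     [[\<theta>^6 * T, \<theta>^4, \<theta>^2 * U, N],
      [T, 1, U, N],
      [T, \<theta>^2, \<theta>^4 * U, \<theta>^6 * N]])"

definition R_matrix :: "real \<Rightarrow> real \<Rightarrow> real mat" where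
  "R_matrix \<theta> X = normalize_rows (mat_of_rows_list 2
     [[\<theta>^3, X],
      [\<theta>, X],
      [1, \<theta> * X],
      [1, \<theta>^3 * X]])"

definition H_matrix ::
  "real \<Rightarrow> real \<Rightarrow> real \<Rightarrow> real \<Rightarrow> real \<Rightarrow> real \<Rightarrow> real \<Rightarrow> real mat" where
  "H_matrix \<theta> X Y Z T U N = P_matrix \<theta> Y Z * Q_matrix \<theta> T U N * R_matrix \<theta> X"

end

theory Submission
  imports Defs
begin

text \<open>The measure is the law of a tree-indexed Markov chain, and the argument is the Kesten--Stigum
second-moment bound. Let \<open>v\<close> be an eigenvector of the effective matrix for the eigenvalue
\<open>\<lambda> \<noteq> 1\<close>; it is not constant, because the matrix is stochastic. Transporting \<open>v\<close> backwards
through the three transition matrices gives one function of the spin for each spin class such that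
averaging the function of a child over its transition law returns the function of the parent,
multiplied by \<open>\<lambda>\<close> on one level out of three and by \<open>1\<close> on the other two
(\<open>transition_P\<close>, \<open>transition_Q\<close>, \<open>transition_R\<close>). Summing these functions over a level and
dividing by the product of the factors (number of children times eigenvalue) therefore gives a
martingale along the levels.

Given the spins up to a level, the spins of the next level are independent
(\<open>mass_join\<close>; this is where compatibility of the boundary fields enters), so the increments of the
martingale are sums of centred uncorrelated terms and their second moments are at most of order
\<open>k ^ n\<close> divided by the square of the normalising product. This ratio shrinks by
\<open>1 / (k ^ 3 * \<lambda>\<^sup>2) < 1\<close> over three levels. Hence the first moments of the increments are summable,
the martingale converges almost surely and in mean, and its limit keeps the conditional mean
\<open>v\<close> given the spin at the root (\<open>tail_limit_root\<close>). The limit depends only on the spins far away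
from the root, and it is not almost surely constant since \<open>v\<close> is not. So the event that the limit
exceeds its mean is a tail event of probability strictly between \<open>0\<close> and \<open>1\<close>.

Finally, \<open>\<mu>\<close> satisfies the DLR equations (\<open>gibbs_measure\<close>), and conditioning a Gibbs measure on a
tail event of positive probability gives a Gibbs measure again (\<open>gibbs_condition_tail\<close>), so \<open>\<mu>\<close>
is a non-trivial mixture of its two conditionings on that event and its complement.\<close>

\<comment> \<open>frees \<open>$\<close> for the entries of vectors as used by \<open>*\<^sub>v\<close>\<close>
unbundle no vec_syntax

section \<open>Levels of the Cayley tree\<close>

definition root_path :: "'v rooted_graph \<Rightarrow> 'v \<Rightarrow> 'v list" where
  "root_path G x = (THE xs. path_betw G (origin G) xs x)"

definition depth :: "'v rooted_graph \<Rightarrow> 'v \<Rightarrow> nat" where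
  "depth G x = length (root_path G x) - 1"

text \<open>The last vertex before \<open>x\<close> on its root path. At the root itself \<open>butlast\<close> is empty and the
value is junk.\<close>

definition parent :: "'v rooted_graph \<Rightarrow> 'v \<Rightarrow> 'v" where
  "parent G x = last (butlast (root_path G x))"

locale cayley_tree =
  fixes G :: "'v rooted_graph" and k :: nat
  assumes k_pos: "k \<ge> 1" and cayley: "semi_infinite_cayley_tree k G"
begin

lemma tree: "is_tree G"
  using cayley by (simp add: semi_infinite_cayley_tree_def)

lemma origin_vert: "origin G \<in> verts G"
  using tree by (simp add: is_tree_def simple_rooted_graph_def)

lemma edge_endpoints:
  assumes "{u, v} \<in> edges G"
  shows "u \<in> verts G" "v \<in> verts G" "u \<noteq> v"
proof -
  have "{u, v} \<subseteq> verts G" "card {u, v} = 2"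
    using assms tree by (auto simp: is_tree_def simple_rooted_graph_def)
  then show "u \<in> verts G" "v \<in> verts G" "u \<noteq> v"
    by auto
qed

lemma edge_pairE:
  assumes "e \<in> edges G"
  obtains u v where "e = {u, v}"
proof -
  have "card e = 2"
    using assms tree by (auto simp: is_tree_def simple_rooted_graph_def)
  then show ?thesis
    using that by (auto simp: card_2_iff)
qed

lemma ex1_root_path: "x \<in> verts G \<Longrightarrow> \<exists>!xs. path_betw G (origin G) xs x"
  using tree origin_vert by (auto simp: is_tree_def)

lemma path_end_vert: "path_betw G u xs x \<Longrightarrow> x \<in> verts G"
  unfolding path_betw_def walk_betw_def by (metis last_in_set subsetD)

lemma root_path: "x \<in> verts G \<Longrightarrow> path_betw G (origin G) (root_path G x) x"
  unfolding root_path_def by (rule theI') (rule ex1_root_path)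

lemma root_path_unique: "path_betw G (origin G) xs x \<Longrightarrow> root_path G x = xs"
  using ex1_root_path[OF path_end_vert] root_path[OF path_end_vert] by blast

lemma root_path_origin: "root_path G (origin G) = [origin G]"
  by (rule root_path_unique) (auto simp: path_betw_def walk_betw_def origin_vert)

lemma path_snoc:
  assumes "path_betw G x xs u" "{u, v} \<in> edges G" "v \<notin> set xs"
  shows "path_betw G x (xs @ [v]) v"
  using assms edge_endpoints[OF assms(2)]
  by (auto simp: path_betw_def walk_betw_def successively_append_iff)

lemma path_prefix:
  assumes "path_betw G x (xs @ v # ys) w"
  shows "path_betw G x (xs @ [v]) v"
proof -
  have "successively (\<lambda>u v. {u, v} \<in> edges G) ((xs @ [v]) @ ys)"
    using assms by (simp add: path_betw_def walk_betw_def)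
  then have "successively (\<lambda>u v. {u, v} \<in> edges G) (xs @ [v])"
    by (subst (asm) successively_append_iff) blast
  moreover have "hd (xs @ [v]) = x" "distinct (xs @ [v])" "set (xs @ [v]) \<subseteq> verts G"
    using assms by (auto simp: path_betw_def walk_betw_def hd_append split: if_splits)
  ultimately show ?thesis
    by (simp add: path_betw_def walk_betw_def)
qed

text \<open>If \<open>v\<close> is not on the root path of \<open>u\<close>, appending \<open>v\<close> to that path gives a path, hence the
root path of \<open>v\<close>. If it is, the initial segment ending in \<open>v\<close> is the root path of \<open>v\<close>, and it
reaches \<open>u\<close> by the edge; uniqueness of paths leaves nothing in between. All the level structure of
the tree comes from this dichotomy.\<close>

lemma root_path_edge:
  assumes e: "{u, v} \<in> edges G"
  shows "root_path G v = root_path G u @ [v] \<or> root_path G u = root_path G v @ [u]"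
proof (cases "v \<in> set (root_path G u)")
  case False
  then show ?thesis
    using root_path_unique[OF path_snoc[OF root_path e]] edge_endpoints[OF e] by auto
next
  case True
  note uv = edge_endpoints[OF e]
  have pu: "path_betw G (origin G) (root_path G u) u"
    using uv by (simp add: root_path)
  obtain xs ys where s: "root_path G u = xs @ v # ys"
    using True by (auto simp: in_set_conv_decomp)
  have pv: "path_betw G (origin G) (xs @ [v]) v"
    using path_prefix pu s by metis
  have "last (xs @ v # ys) = u" "distinct (xs @ v # ys)"
    using pu s by (auto simp: path_betw_def walk_betw_def)
  then have "u \<in> set ys" "u \<notin> set (xs @ [v])"
    using uv by (auto split: if_splits)
  then have "root_path G u = (xs @ [v]) @ [u]"
    using e by (intro root_path_unique path_snoc[OF pv]) (simp_all add: insert_commute)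
  then show ?thesis
    using root_path_unique[OF pv] by simp
qed

lemma length_root_path: "x \<in> verts G \<Longrightarrow> length (root_path G x) = Suc (depth G x)"
  using root_path[of x] by (cases "root_path G x") (auto simp: depth_def path_betw_def walk_betw_def)

lemma depth_edge:
  assumes "{u, v} \<in> edges G"
  shows "depth G v = Suc (depth G u) \<and> parent G v = u \<or> depth G u = Suc (depth G v) \<and> parent G u = v"
proof -
  have last: "last (root_path G x) = x" if "x \<in> verts G" for x
    using root_path[OF that] by (simp add: path_betw_def walk_betw_def)
  show ?thesis
    using root_path_edge[OF assms] edge_endpoints[OF assms] length_root_path[of u] length_root_path[of v]
    by (auto simp: parent_def last)
qed

text \<open>Depth changes by one along an edge, so no walk from the root is shorter than the root path; this
identifies depth with graph distance.\<close>

lemma depth_walk: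
  assumes "walk_betw G (origin G) xs x"
  shows "depth G x < length xs"
  using assms
proof (induction xs arbitrary: x rule: rev_induct)
  case Nil
  then show ?case by (simp add: walk_betw_def)
next
  case (snoc y ys)
  show ?case
  proof (cases "ys = []")
    case True
    then show ?thesis
      using snoc.prems by (auto simp: walk_betw_def depth_def root_path_origin)
  next
    case False
    then have w: "walk_betw G (origin G) ys (last ys)" and e: "{last ys, x} \<in> edges G"
      using snoc.prems by (auto simp: walk_betw_def successively_append_iff)
    show ?thesis
      using snoc.IH[OF w] depth_edge[OF e] by auto
  qed
qed

lemma walk_rev: "walk_betw G x xs y \<Longrightarrow> walk_betw G y (rev xs) x"
  by (auto simp: walk_betw_def hd_rev last_rev successively_rev insert_commute)

lemma graph_dist_origin:
  assumes "x \<in> verts G"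
  shows "graph_dist G (origin G) x = depth G x"
  unfolding graph_dist_def
proof (rule Least_equality)
  show "\<exists>xs. walk_betw G (origin G) xs x \<and> length xs = Suc (depth G x)"
    using root_path[OF assms] length_root_path[OF assms] by (auto simp: path_betw_def)
qed (use depth_walk in fastforce)

lemma graph_dist_sym: "graph_dist G x y = graph_dist G y x"
proof -
  have "(\<exists>xs. walk_betw G x xs y \<and> length xs = n) \<longleftrightarrow> (\<exists>xs. walk_betw G y xs x \<and> length xs = n)" for n
    by (metis walk_rev length_rev)
  then show ?thesis
    by (simp add: graph_dist_def)
qed

lemma level_eq: "level G n = {x \<in> verts G. depth G x = n}"
  by (auto simp: level_def graph_dist_sym[of _ "origin G"] graph_dist_origin)

lemma vertex_class_eq: "vertex_class G i = {x \<in> verts G. depth G x mod 3 = i}"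
  by (auto simp: vertex_class_def graph_dist_origin)

lemma tree_ball_eq: "tree_ball G n = {x \<in> verts G. depth G x \<le> n}"
  by (auto simp: tree_ball_def level_eq)

lemma tree_ball_Suc: "tree_ball G (Suc n) = tree_ball G n \<union> level G (Suc n)"
  and tree_ball_level_disjoint: "tree_ball G n \<inter> level G (Suc n) = {}"
  and level_subset_ball: "level G n \<subseteq> tree_ball G n"
  and tree_ball_verts: "tree_ball G n \<subseteq> verts G"
  by (auto simp: tree_ball_eq level_eq)

lemma level_0: "level G 0 = {origin G}"
proof -
  have "x = origin G" if "x \<in> verts G" "depth G x = 0" for x
  proof -
    have "length (root_path G x) = 1"
      using length_root_path[OF that(1)] that(2) by simp
    then obtain z where "root_path G x = [z]"
      by (auto simp: length_Suc_conv)
    then show ?thesis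
      using root_path[OF that(1)] by (auto simp: path_betw_def walk_betw_def)
  qed
  then have "level G 0 \<subseteq> {origin G}"
    unfolding level_eq by blast
  moreover have "origin G \<in> level G 0"
    using origin_vert by (simp add: level_eq depth_def root_path_origin)
  ultimately show ?thesis
    by blast
qed

lemma tree_ball_0: "tree_ball G 0 = {origin G}"
  using level_0 by (simp add: tree_ball_def)

lemma parent_edge:
  assumes y: "y \<in> level G (Suc n)"
  shows "{parent G y, y} \<in> edges G" "parent G y \<in> level G n"
proof -
  have yv: "y \<in> verts G" and l: "length (root_path G y) = Suc (Suc n)"
    using y length_root_path[of y] by (auto simp: level_eq)
  obtain xs where xs: "root_path G y = xs @ [y]"
    using root_path[OF yv] by (metis append_butlast_last_id path_betw_def walk_betw_def)
  have ne: "xs \<noteq> []" using l xs by auto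
  show e: "{parent G y, y} \<in> edges G"
    using root_path[OF yv] ne
    by (auto simp: xs parent_def path_betw_def walk_betw_def successively_append_iff)
  then have "depth G y = Suc (depth G (parent G y)) \<or> depth G (parent G y) = Suc (depth G y)"
    using depth_edge by blast
  moreover have "root_path G (parent G y) = xs"
  proof (rule root_path_unique)
    obtain zs u where zs: "xs = zs @ [u]" using ne by (metis append_butlast_last_id)
    then have "parent G y = u" by (simp add: parent_def xs butlast_append)
    then show "path_betw G (origin G) xs (parent G y)"
      using root_path[OF yv] path_prefix[of _ zs u "[y]" y] by (simp add: xs zs)
  qed
  ultimately show "parent G y \<in> level G n"
    using edge_endpoints[OF e] y l xs by (auto simp: level_eq depth_def)
qed

lemma incident_edges_finite: 
  assumes "x \<in> verts G"
  shows "finite {e \<in> edges G. x \<in> e}"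
proof (rule card_ge_0_finite)
  show "card {e \<in> edges G. x \<in> e} > 0"
    using cayley assms k_pos by (auto simp: semi_infinite_cayley_tree_def vertex_degree_def)
qed

lemma incident_edges:
  assumes "x \<in> level G n"
  shows "{e \<in> edges G. x \<in> e} = (if x = origin G then {} else {{parent G x, x}}) \<union>
           (\<lambda>y. {x, y}) ` {y \<in> level G (Suc n). parent G y = x}" (is "?L = ?A \<union> ?B")
proof
  show "?L \<subseteq> ?A \<union> ?B"
  proof
    fix e assume e: "e \<in> ?L"
    then obtain u v where "e = {u, v}" using edge_pairE by blast
    then obtain w where w: "e = {x, w}" using e by auto
    then have ew: "{x, w} \<in> edges G" using e by auto
    have "x \<noteq> origin G" if "depth G x = Suc (depth G w)"
      using that by (auto simp: depth_def root_path_origin)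
    then show "e \<in> ?A \<union> ?B"
      using depth_edge[OF ew] edge_endpoints[OF ew] assms w by (auto simp: level_eq)
  qed
  have "{parent G x, x} \<in> edges G" if "x \<noteq> origin G"
    using parent_edge[of x "n - 1"] level_0 assms that by (cases n) auto
  moreover have "{x, y} \<in> edges G" if "y \<in> level G (Suc n)" "parent G y = x" for y
    using parent_edge(1) that by blast
  ultimately show "?A \<union> ?B \<subseteq> ?L"
    by auto
qed

text \<open>The degree condition counts all incident edges. Away from the root one of them leads to the
parent, which turns \<open>k + 1\<close> edges into \<open>k\<close> children; at the root all \<open>k\<close> edges lead to children.\<close>

lemma card_children:
  assumes x: "x \<in> level G n"
  shows "finite {y \<in> level G (Suc n). parent G y = x}" "card {y \<in> level G (Suc n). parent G y = x} = k"
proof -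
  let ?C = "{y \<in> level G (Suc n). parent G y = x}"
  let ?f = "\<lambda>y. {x, y}"
  have xv: "x \<in> verts G" using x by (simp add: level_eq)
  have inj: "inj_on ?f ?C"
    by (auto simp: inj_on_def doubleton_eq_iff)
  have "finite (?f ` ?C)"
    using incident_edges_finite[OF xv] incident_edges[OF x] by simp
  then show fin: "finite ?C"
    using inj by (simp add: finite_image_iff)
  have deg: "card {e \<in> edges G. x \<in> e} = (if x = origin G then k else k + 1)"
    using cayley xv by (auto simp: semi_infinite_cayley_tree_def vertex_degree_def)
  show "card ?C = k"
  proof (cases "x = origin G")
    case True
    then show ?thesis
      using deg incident_edges[OF x] card_image[OF inj] by simp
  next
    case False
    then obtain m where m: "n = Suc m"
      using x level_0 by (cases n) auto
    have "parent G x \<in> level G m"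
      using parent_edge x m by simp
    then have "parent G x \<notin> ?C" "parent G x \<noteq> x"
      using x m by (simp_all add: level_eq) (metis n_not_Suc_n)
    then have new: "{parent G x, x} \<notin> ?f ` ?C"
      by (metis (no_types, lifting) doubleton_eq_iff imageE)
    then show ?thesis
      using deg incident_edges[OF x] card_image[OF inj] False fin new by simp
  qed
qed

lemma level_Suc_children: "level G (Suc n) = (\<Union>x\<in>level G n. {y \<in> level G (Suc n). parent G y = x})"
  using parent_edge(2) by auto

lemma finite_level: "finite (level G n)"
proof (induction n)
  case (Suc n)
  then show ?case
    using card_children(1) by (subst level_Suc_children) (rule finite_UN_I)
qed (simp add: level_0)

lemma finite_tree_ball: "finite (tree_ball G n)"
  by (simp add: tree_ball_def finite_level)

lemma sum_over_parents:
  fixes f :: "'v \<Rightarrow> real"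
  shows "(\<Sum>y\<in>level G (Suc n). f (parent G y)) = real k * (\<Sum>x\<in>level G n. f x)"
proof -
  have "(\<Sum>y\<in>level G (Suc n). f (parent G y)) =
      (\<Sum>x\<in>level G n. \<Sum>y | y \<in> level G (Suc n) \<and> parent G y = x. f (parent G y))"
    using parent_edge(2) by (intro sum.group[symmetric]) (auto simp: finite_level)
  also have "\<dots> = (\<Sum>x\<in>level G n. real k * f x)"
    by (intro sum.cong refl) (simp add: card_children)
  finally show ?thesis
    by (simp add: sum_distrib_left)
qed

lemma card_level: "real (card (level G n)) = real k ^ n"
proof (induction n)
  case (Suc n)
  then show ?case
    using sum_over_parents[of "\<lambda>_. 1" n] by simp
qed (simp add: level_0)

lemma ball_edges_0: "ball_edges G 0 = {}"
proof -
  have False if "e \<in> edges G" "e \<subseteq> {origin G}" for e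
    using that edge_pairE edge_endpoints(3) by (metis insert_subset singletonD)
  then show ?thesis
    by (auto simp: ball_edges_def tree_ball_0)
qed

lemma ball_edges_Suc:
  "ball_edges G (Suc n) = ball_edges G n \<union> (\<lambda>y. {parent G y, y}) ` level G (Suc n)" (is "_ = _ \<union> ?B")
proof
  show "ball_edges G (Suc n) \<subseteq> ball_edges G n \<union> ?B"
  proof
    fix e assume e: "e \<in> ball_edges G (Suc n)"
    then have eE: "e \<in> edges G" and eb: "e \<subseteq> tree_ball G (Suc n)" by (auto simp: ball_edges_def)
    obtain u v where uv: "e = {u, v}" using edge_pairE[OF eE] .
    show "e \<in> ball_edges G n \<union> ?B"
    proof (cases "e \<subseteq> tree_ball G n")
      case True
      then show ?thesis using eE by (simp add: ball_edges_def)
    next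
      case False
      then have "u \<in> level G (Suc n) \<or> v \<in> level G (Suc n)"
        using eb uv by (auto simp: tree_ball_Suc)
      moreover have "depth G u \<le> Suc n" "depth G v \<le> Suc n"
        using eb uv by (auto simp: tree_ball_eq)
      ultimately have "(v \<in> level G (Suc n) \<and> parent G v = u) \<or> (u \<in> level G (Suc n) \<and> parent G u = v)"
        using depth_edge[of u v] edge_endpoints[of u v] eE uv by (auto simp: level_eq)
      then show ?thesis
        using uv by auto
    qed
  qed
  show "ball_edges G n \<union> ?B \<subseteq> ball_edges G (Suc n)"
    using parent_edge level_subset_ball[of n]
    by (auto simp: ball_edges_def tree_ball_Suc)
qed

lemma finite_ball_edges: "finite (ball_edges G n)"
  by (induction n) (simp_all add: ball_edges_0 ball_edges_Suc finite_level)

text \<open>The reason why finite-volume Gibbs weights are functions of the spins in a slightly larger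
ball.\<close>

lemma edges_meeting_ball:
  assumes "\<Lambda> \<subseteq> tree_ball G n"
  shows "{e \<in> edges G. e \<inter> \<Lambda> \<noteq> {}} \<subseteq> ball_edges G (Suc n)"
proof
  fix e assume e: "e \<in> {e \<in> edges G. e \<inter> \<Lambda> \<noteq> {}}"
  then obtain u v where uv: "e = {u, v}" using edge_pairE by blast
  have "u \<in> tree_ball G n \<or> v \<in> tree_ball G n"
    using e uv assms by auto
  then show "e \<in> ball_edges G (Suc n)"
    using depth_edge[of u v] edge_endpoints[of u v] e uv by (auto simp: tree_ball_eq ball_edges_def)
qed

lemma finite_subset_ball:
  assumes "finite \<Lambda>" "\<Lambda> \<subseteq> verts G"
  obtains n where "\<Lambda> \<subseteq> tree_ball G n"
proof
  show "\<Lambda> \<subseteq> tree_ball G (Max (depth G ` \<Lambda>))"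
    using assms by (auto simp: tree_ball_eq)
qed

lemma tree_ball_mono: "m \<le> n \<Longrightarrow> tree_ball G m \<subseteq> tree_ball G n"
  by (auto simp: tree_ball_eq)

end

section \<open>Product weights\<close>

lemma sum_PiE_Un:
  assumes "A \<inter> B = {}"
  shows "(\<Sum>\<xi>\<in>PiE (A \<union> B) S. f \<xi>) = (\<Sum>\<zeta>\<in>PiE A S. \<Sum>\<omega>\<in>PiE B S. f (merge A B (\<zeta>, \<omega>)))"
proof -
  have "(\<Sum>\<xi>\<in>PiE (A \<union> B) S. f \<xi>) = (\<Sum>p\<in>PiE A S \<times> PiE B S. f (merge A B p))"
  proof (rule sum.reindex_bij_witness[where i = "merge A B" and j = "\<lambda>\<xi>. (restrict \<xi> A, restrict \<xi> B)"])
    fix p assume "p \<in> PiE A S \<times> PiE B S"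
    then obtain \<zeta> \<omega> where p: "p = (\<zeta>, \<omega>)" and mem: "\<zeta> \<in> PiE A S" "\<omega> \<in> PiE B S"
      by auto
    show "(restrict (merge A B p) A, restrict (merge A B p) B) = p"
      using mem assms by (simp add: p PiE_restrict)
    show "merge A B p \<in> PiE (A \<union> B) S"
      using mem by (auto simp: p PiE_iff merge_def extensional_def)
  next
    fix \<xi> assume \<xi>: "\<xi> \<in> PiE (A \<union> B) S"
    show "merge A B (restrict \<xi> A, restrict \<xi> B) = \<xi>"
      using \<xi> by (auto simp: merge_def PiE_iff extensional_def fun_eq_iff)
    then show "f (merge A B (restrict \<xi> A, restrict \<xi> B)) = f \<xi>"
      by simp
    show "(restrict \<xi> A, restrict \<xi> B) \<in> PiE A S \<times> PiE B S"
      using \<xi> by auto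
  qed
  then show ?thesis
    by (simp add: sum.cartesian_product case_prod_unfold)
qed

text \<open>The next three lemmas are the moments of independent coordinates, for a product of finite weights:
coordinates not involved in the integrand sum to \<open>1\<close>, and centred functions of distinct coordinates are
uncorrelated.\<close>

lemma product_weight_expectation_one:
  fixes p f :: "'a \<Rightarrow> 'b \<Rightarrow> real"
  assumes fin: "finite I" "\<And>i. i \<in> I \<Longrightarrow> finite (S i)"
    and norm: "\<And>i. i \<in> I \<Longrightarrow> (\<Sum>s\<in>S i. p i s) = 1" and i: "i \<in> I"
  shows "(\<Sum>\<omega>\<in>PiE I S. (\<Prod>j\<in>I. p j (\<omega> j)) * f i (\<omega> i)) = (\<Sum>s\<in>S i. p i s * f i s)"
proof -
  let ?q = "\<lambda>j s. p j s * (if j = i then f i s else 1)"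
  have "(\<Sum>\<omega>\<in>PiE I S. (\<Prod>j\<in>I. p j (\<omega> j)) * f i (\<omega> i)) = (\<Sum>\<omega>\<in>PiE I S. \<Prod>j\<in>I. ?q j (\<omega> j))"
    using fin i by (simp add: prod.distrib)
  also have "\<dots> = (\<Prod>j\<in>I. \<Sum>s\<in>S j. ?q j s)"
    using fin by (rule prod_sum_PiE[symmetric])
  also have "\<dots> = (\<Prod>j\<in>I. if j = i then \<Sum>s\<in>S i. p i s * f i s else 1)"
    using norm by (intro prod.cong) auto
  finally show ?thesis
    using fin i by simp
qed

lemma product_weight_expectation_two:
  fixes p f :: "'a \<Rightarrow> 'b \<Rightarrow> real"
  assumes fin: "finite I" "\<And>i. i \<in> I \<Longrightarrow> finite (S i)"
    and norm: "\<And>i. i \<in> I \<Longrightarrow> (\<Sum>s\<in>S i. p i s) = 1"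
    and ij: "i \<in> I" "j \<in> I" "i \<noteq> j"
  shows "(\<Sum>\<omega>\<in>PiE I S. (\<Prod>l\<in>I. p l (\<omega> l)) * (f i (\<omega> i) * f j (\<omega> j))) =
           (\<Sum>s\<in>S i. p i s * f i s) * (\<Sum>s\<in>S j. p j s * f j s)"
proof -
  let ?e = "\<lambda>l. if l = i \<or> l = j then \<Sum>s\<in>S l. p l s * f l s else 1"
  let ?q = "\<lambda>l s. p l s * (if l = i \<or> l = j then f l s else 1)"
  have pick: "(\<Prod>l\<in>I. if l = i \<or> l = j then F l else 1) = F i * F j" for F :: "'a \<Rightarrow> real"
  proof -
    have "(\<Prod>l\<in>I. if l = i \<or> l = j then F l else 1) = (\<Prod>l\<in>{i, j}. F l)"
      using fin ij by (intro prod.mono_neutral_cong_right) auto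
    then show ?thesis using ij by simp
  qed
  have "(\<Sum>\<omega>\<in>PiE I S. (\<Prod>l\<in>I. p l (\<omega> l)) * (f i (\<omega> i) * f j (\<omega> j))) =
          (\<Sum>\<omega>\<in>PiE I S. \<Prod>l\<in>I. ?q l (\<omega> l))"
    by (simp only: prod.distrib pick)
  also have "\<dots> = (\<Prod>l\<in>I. \<Sum>s\<in>S l. ?q l s)"
    using fin by (rule prod_sum_PiE[symmetric])
  also have "\<dots> = (\<Prod>l\<in>I. ?e l)"
    using norm by (intro prod.cong) auto
  finally show ?thesis
    by (simp only: pick)
qed

lemma product_weight_sum_square:
  fixes p d :: "'a \<Rightarrow> 'b \<Rightarrow> real"
  assumes fin: "finite I" "\<And>i. i \<in> I \<Longrightarrow> finite (S i)"
    and norm: "\<And>i. i \<in> I \<Longrightarrow> (\<Sum>s\<in>S i. p i s) = 1"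
    and centred: "\<And>i. i \<in> I \<Longrightarrow> (\<Sum>s\<in>S i. p i s * d i s) = 0"
  shows "(\<Sum>\<omega>\<in>PiE I S. (\<Prod>j\<in>I. p j (\<omega> j)) * (\<Sum>i\<in>I. d i (\<omega> i))\<^sup>2) =
           (\<Sum>i\<in>I. \<Sum>s\<in>S i. p i s * (d i s)\<^sup>2)"
proof -
  let ?P = "\<lambda>\<omega>. \<Prod>j\<in>I. p j (\<omega> j)"
  have pair: "(\<Sum>\<omega>\<in>PiE I S. ?P \<omega> * (d i (\<omega> i) * d j (\<omega> j))) =
      (if i = j then \<Sum>s\<in>S i. p i s * (d i s)\<^sup>2 else 0)" if "i \<in> I" "j \<in> I" for i j
  proof (cases "i = j")
    case True
    then show ?thesis
      using product_weight_expectation_one[OF fin norm \<open>i \<in> I\<close>, where f = "\<lambda>i s. (d i s)\<^sup>2"]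
      by (simp add: power2_eq_square)
  next
    case False
    then show ?thesis
      using product_weight_expectation_two[OF fin norm that False, where f = d] centred[OF that(1)] by simp
  qed
  have "(\<Sum>\<omega>\<in>PiE I S. ?P \<omega> * (\<Sum>i\<in>I. d i (\<omega> i))\<^sup>2) =
      (\<Sum>\<omega>\<in>PiE I S. \<Sum>i\<in>I. \<Sum>j\<in>I. ?P \<omega> * (d i (\<omega> i) * d j (\<omega> j)))"
    by (simp only: power2_eq_square sum_product) (simp only: sum_distrib_left)
  also have "\<dots> = (\<Sum>i\<in>I. \<Sum>j\<in>I. \<Sum>\<omega>\<in>PiE I S. ?P \<omega> * (d i (\<omega> i) * d j (\<omega> j)))"
    by (subst sum.swap, rule sum.cong[OF refl], rule sum.swap)
  also have "\<dots> = (\<Sum>i\<in>I. \<Sum>j\<in>I. if i = j then \<Sum>s\<in>S i. p i s * (d i s)\<^sup>2 else 0)"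
    by (intro sum.cong refl pair)
  finally show ?thesis
    using fin by simp
qed

lemma finite_spin_set: "finite (spin_set G x)"
  and spin_set_nonempty: "spin_set G x \<noteq> {}"
  by (simp_all add: spin_set_def Psi_spins_def Phi_spins_def Upsilon_spins_def)

lemma finite_configs_on: "finite A \<Longrightarrow> finite (configs_on G A)"
  by (simp add: configs_on_def finite_PiE finite_spin_set)

lemma configs_on_nonempty: "configs_on G A \<noteq> {}"
  by (simp add: configs_on_def PiE_eq_empty_iff spin_set_nonempty)

lemma energy_cong: "(\<And>e x. e \<in> E \<Longrightarrow> x \<in> e \<Longrightarrow> \<xi> x = \<zeta> x) \<Longrightarrow> energy J E \<xi> = energy J E \<zeta>"
  by (simp add: energy_def)

section \<open>Splitting measures as tree-indexed Markov chains\<close>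

locale splitting_measure = cayley_tree G k
  for G :: "'v rooted_graph" and k +
  fixes J \<beta> :: real and h :: "'v \<Rightarrow> real \<Rightarrow> real" and \<mu> :: "('v \<Rightarrow> real) measure"
  assumes sgm: "splitting_gibbs_measure G J \<beta> h \<mu>"
begin

sublocale prob_space \<mu>
  using sgm by (simp add: splitting_gibbs_measure_def)

text \<open>The factor which a vertex \<open>y\<close> with spin \<open>t\<close> and parent spin \<open>s\<close> contributes to the weight of a
configuration: its edge to the parent together with its boundary field.\<close>

definition branch :: "'v \<Rightarrow> real \<Rightarrow> real \<Rightarrow> real" where
  "branch y s t = exp (\<beta> * J * s * t + h y t)"

definition transition :: "'v \<Rightarrow> real \<Rightarrow> real \<Rightarrow> real" where
  "transition y s t = branch y s t / (\<Sum>t'\<in>spin_set G y. branch y s t')"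

lemma branch_sum_pos: "(\<Sum>t\<in>spin_set G y. branch y s t) > 0"
  by (intro sum_pos) (auto simp: branch_def finite_spin_set spin_set_nonempty)

lemma transition_nonneg: "transition y s t \<ge> 0"
  using branch_sum_pos[of y s] by (simp add: transition_def branch_def)

lemma transition_sum: "(\<Sum>t\<in>spin_set G y. transition y s t) = 1"
  using branch_sum_pos[of y s] by (simp add: transition_def flip: sum_divide_distrib)

abbreviation join :: "nat \<Rightarrow> ('v \<Rightarrow> real) \<Rightarrow> ('v \<Rightarrow> real) \<Rightarrow> 'v \<Rightarrow> real" where
  "join n \<zeta> \<omega> \<equiv> merge (tree_ball G n) (level G (Suc n)) (\<zeta>, \<omega>)"

lemma join_ball: "x \<in> tree_ball G n \<Longrightarrow> join n \<zeta> \<omega> x = \<zeta> x"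
  by (simp add: merge_def)

lemma join_level: "x \<in> level G (Suc n) \<Longrightarrow> join n \<zeta> \<omega> x = \<omega> x"
  using tree_ball_level_disjoint[of n] by (auto simp: merge_def)

lemma join_parent: "y \<in> level G (Suc n) \<Longrightarrow> join n \<zeta> \<omega> (parent G y) = \<zeta> (parent G y)"
  using parent_edge(2) level_subset_ball by (intro join_ball) blast

lemma sum_configs_Suc:
  "(\<Sum>\<xi>\<in>configs_on G (tree_ball G (Suc n)). f \<xi>) =
     (\<Sum>\<zeta>\<in>configs_on G (tree_ball G n). \<Sum>\<omega>\<in>configs_on G (level G (Suc n)). f (join n \<zeta> \<omega>))"
  by (simp add: configs_on_def tree_ball_Suc sum_PiE_Un tree_ball_level_disjoint)

lemma energy_join:
  "energy J (ball_edges G (Suc n)) (join n \<zeta> \<omega>) =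
     energy J (ball_edges G n) \<zeta> - J * (\<Sum>y\<in>level G (Suc n). \<zeta> (parent G y) * \<omega> y)"
proof -
  let ?B = "(\<lambda>y. {parent G y, y}) ` level G (Suc n)"
  let ?\<xi> = "join n \<zeta> \<omega>"
  have neq: "parent G y \<noteq> y" if "y \<in> level G (Suc n)" for y
    using edge_endpoints(3)[OF parent_edge(1)[OF that]] .
  have inj: "inj_on (\<lambda>y. {parent G y, y}) (level G (Suc n))"
  proof (rule inj_onI)
    fix y z assume "y \<in> level G (Suc n)" "z \<in> level G (Suc n)" "{parent G y, y} = {parent G z, z}"
    moreover from this have "parent G y \<noteq> z"
      using parent_edge(2)[of y n] by (auto simp: level_eq)
    ultimately show "y = z"
      by (auto simp: doubleton_eq_iff)
  qed
  have disj: "ball_edges G n \<inter> ?B = {}"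
    using tree_ball_level_disjoint[of n] by (auto simp: ball_edges_def)
  have old: "energy J (ball_edges G n) ?\<xi> = energy J (ball_edges G n) \<zeta>"
    by (rule energy_cong) (auto simp: ball_edges_def join_ball)
  have "(\<Sum>e\<in>?B. \<Prod>x\<in>e. ?\<xi> x) = (\<Sum>y\<in>level G (Suc n). \<Prod>x\<in>{parent G y, y}. ?\<xi> x)"
    by (simp add: sum.reindex[OF inj])
  also have "\<dots> = (\<Sum>y\<in>level G (Suc n). \<zeta> (parent G y) * \<omega> y)"
    by (intro sum.cong refl) (simp add: neq join_parent join_level)
  finally have new: "(\<Sum>e\<in>?B. \<Prod>x\<in>e. ?\<xi> x) = (\<Sum>y\<in>level G (Suc n). \<zeta> (parent G y) * \<omega> y)" .
  have "energy J (ball_edges G (Suc n)) ?\<xi> = energy J (ball_edges G n) ?\<xi> - J * (\<Sum>e\<in>?B. \<Prod>x\<in>e. ?\<xi> x)"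
    unfolding energy_def ball_edges_Suc
    using disj by (subst sum.union_disjoint) (auto simp: finite_ball_edges finite_level algebra_simps)
  then show ?thesis
    by (simp add: old new)
qed

abbreviation mass :: "nat \<Rightarrow> ('v \<Rightarrow> real) \<Rightarrow> real" where
  "mass n \<equiv> sgm_mass G J \<beta> h n"

lemma mass_pos: "mass n \<xi> > 0"
  unfolding sgm_mass_def
  by (intro divide_pos_pos sum_pos) 
    (auto simp: sgm_weight_def finite_configs_on finite_tree_ball configs_on_nonempty)

text \<open>The Markov property. The weight at radius \<open>n + 1\<close> is the weight at radius \<open>n\<close> without its
boundary terms, times one \<open>branch\<close> factor per new vertex. So the masses of the extensions of \<open>\<zeta>\<close>
are proportional to the products of these factors, and compatibility says that they add up to the mass
of \<open>\<zeta>\<close>. The sum of the products factorises over the new vertices, which normalises each factor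
separately.\<close>

lemma mass_join:
  assumes "\<zeta> \<in> configs_on G (tree_ball G n)" 
  shows "mass (Suc n) (join n \<zeta> \<omega>) =
    mass n \<zeta> * (\<Prod>y\<in>level G (Suc n). transition y (\<zeta> (parent G y)) (\<omega> y))"
proof -
  let ?L = "level G (Suc n)"
  define Z where "Z = (\<Sum>\<xi>\<in>configs_on G (tree_ball G (Suc n)). sgm_weight G J \<beta> h (Suc n) \<xi>)"
  define c where "c = exp (- \<beta> * energy J (ball_edges G n) \<zeta>) / Z"
  \<comment> \<open>the same constant \<open>c\<close> serves for all \<open>\<omega>\<close>, so it is determined by the sum over \<open>\<omega>\<close>\<close>
  have unnormalised: "mass (Suc n) (join n \<zeta> \<omega>) = c * (\<Prod>y\<in>?L. branch y (\<zeta> (parent G y)) (\<omega> y))" for \<omega>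
  proof -
    have "sgm_weight G J \<beta> h (Suc n) (join n \<zeta> \<omega>) =
        exp (- \<beta> * energy J (ball_edges G n) \<zeta> +
          (\<Sum>y\<in>?L. \<beta> * J * \<zeta> (parent G y) * \<omega> y + h y (\<omega> y)))"
      by (simp add: sgm_weight_def energy_join join_level sum.distrib sum_distrib_left sum_negf algebra_simps)
    also have "\<dots> = exp (- \<beta> * energy J (ball_edges G n) \<zeta>) * (\<Prod>y\<in>?L. branch y (\<zeta> (parent G y)) (\<omega> y))"
      by (simp only: exp_add exp_sum[OF finite_level] branch_def)
    finally show ?thesis
      by (simp add: sgm_mass_def c_def Z_def)
  qed
  have "mass n \<zeta> = (\<Sum>\<omega>\<in>configs_on G ?L. mass (Suc n) (join n \<zeta> \<omega>))"
    using sgm assms by (fastforce simp: splitting_gibbs_measure_def compatible_family_def)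
  also have "\<dots> = c * (\<Sum>\<omega>\<in>configs_on G ?L. \<Prod>y\<in>?L. branch y (\<zeta> (parent G y)) (\<omega> y))"
    by (simp only: unnormalised sum_distrib_left)
  also have "\<dots> = c * (\<Prod>y\<in>?L. \<Sum>t\<in>spin_set G y. branch y (\<zeta> (parent G y)) t)"
    by (simp add: configs_on_def prod_sum_PiE finite_level finite_spin_set)
  finally show ?thesis
    using branch_sum_pos
    by (simp add: unnormalised transition_def prod_dividef prod_pos less_imp_neq[symmetric])
qed

lemma expectation_step:
  "(\<Sum>\<xi>\<in>configs_on G (tree_ball G (Suc n)). mass (Suc n) \<xi> * f \<xi>) =
     (\<Sum>\<zeta>\<in>configs_on G (tree_ball G n). mass n \<zeta> * (\<Sum>\<omega>\<in>configs_on G (level G (Suc n)).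
        (\<Prod>y\<in>level G (Suc n). transition y (\<zeta> (parent G y)) (\<omega> y)) * f (join n \<zeta> \<omega>)))"
  by (simp add: sum_configs_Suc mass_join sum_distrib_left mult.assoc)

lemma sets_config: "sets \<mu> = sets (config_space G)"
  using sgm by (simp add: splitting_gibbs_measure_def)

lemma space_config: "space \<mu> = configs_on G (verts G)"
  using sets_eq_imp_space_eq[OF sets_config] by (simp add: config_space_def space_PiM configs_on_def)

lemma spin_measurable [measurable]:
  assumes "x \<in> verts G"
  shows "(\<lambda>\<sigma>. \<sigma> x) \<in> measurable \<mu> (count_space (spin_set G x))"
  using assms unfolding measurable_cong_sets[OF sets_config refl] config_space_def by measurable

lemma spin_borel_measurable:
  assumes "x \<in> verts G"
  shows "(\<lambda>\<sigma>. f (\<sigma> x) :: real) \<in> borel_measurable \<mu>"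
  using measurable_compose[OF spin_measurable[OF assms], where g = f and L = borel] by simp

lemma restrict_configs: "\<sigma> \<in> space \<mu> \<Longrightarrow> A \<subseteq> verts G \<Longrightarrow> restrict \<sigma> A \<in> configs_on G A"
  by (auto simp: space_config configs_on_def)

lemma restrict_measurable:
  "(\<lambda>\<sigma>. restrict \<sigma> (tree_ball G n)) \<in> measurable \<mu> (count_space (configs_on G (tree_ball G n)))"
proof (subst measurable_count_space_eq2)
  show "finite (configs_on G (tree_ball G n))"
    by (simp add: finite_configs_on finite_tree_ball)
  let ?r = "\<lambda>\<sigma>. restrict \<sigma> (tree_ball G n)"
  have "?r -` {\<zeta>} \<inter> space \<mu> \<in> sets \<mu>" if \<zeta>: "\<zeta> \<in> configs_on G (tree_ball G n)" for \<zeta>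
  proof -
    have "?r -` {\<zeta>} \<inter> space \<mu> = {\<sigma> \<in> space \<mu>. \<forall>x\<in>tree_ball G n. \<sigma> x = \<zeta> x}"
      using \<zeta> by (auto simp: configs_on_def PiE_iff extensional_def restrict_def fun_eq_iff)
    also have "\<dots> \<in> sets \<mu>"
    proof (rule sets.sets_Collect_finite_All[OF _ finite_tree_ball])
      fix x assume "x \<in> tree_ball G n"
      then have "x \<in> verts G" using tree_ball_verts by blast
      then show "{\<sigma> \<in> space \<mu>. \<sigma> x = \<zeta> x} \<in> sets \<mu>"
        using spin_borel_measurable[of x "\<lambda>s. s"] by measurable
    qed
    finally show ?thesis .
  qed
  then show "?r \<in> space \<mu> \<rightarrow> configs_on G (tree_ball G n) \<and>
      (\<forall>\<zeta>\<in>configs_on G (tree_ball G n). ?r -` {\<zeta>} \<inter> space \<mu> \<in> sets \<mu>)"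
    using restrict_configs tree_ball_verts by blast
qed

lemma cylinder_measurable: "(\<lambda>\<sigma>. f (restrict \<sigma> (tree_ball G n)) :: real) \<in> borel_measurable \<mu>"
  using measurable_compose[OF restrict_measurable, where g = f and L = borel] by simp

lemma cylinder_sets: "{\<sigma> \<in> space \<mu>. restrict \<sigma> (tree_ball G n) = \<zeta>} \<in> sets \<mu>"
  using cylinder_measurable[of "\<lambda>\<xi>. of_bool (\<xi> = \<zeta>)" n]
      borel_measurable_eq[of "\<lambda>\<sigma>. of_bool (restrict \<sigma> (tree_ball G n) = \<zeta>)" \<mu> "\<lambda>_. 1 :: real"]
  by simp

lemma cylinder_integral:
  fixes f :: "('v \<Rightarrow> real) \<Rightarrow> real"
  shows "integrable \<mu> (\<lambda>\<sigma>. f (restrict \<sigma> (tree_ball G n)))"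
    and "(\<integral>\<sigma>. f (restrict \<sigma> (tree_ball G n)) \<partial>\<mu>) = (\<Sum>\<zeta>\<in>configs_on G (tree_ball G n). mass n \<zeta> * f \<zeta>)"
proof -
  let ?C = "configs_on G (tree_ball G n)"
  let ?A = "\<lambda>\<zeta>. {\<sigma> \<in> space \<mu>. restrict \<sigma> (tree_ball G n) = \<zeta>}"
  have fin: "finite ?C"
    by (simp add: finite_configs_on finite_tree_ball)
  have eq: "f (restrict \<sigma> (tree_ball G n)) = (\<Sum>\<zeta>\<in>?C. f \<zeta> * indicator (?A \<zeta>) \<sigma>)" if "\<sigma> \<in> space \<mu>" for \<sigma>
  proof -
    have "(\<Sum>\<zeta>\<in>?C. f \<zeta> * indicator (?A \<zeta>) \<sigma>) =
        (\<Sum>\<zeta>\<in>?C. if \<zeta> = restrict \<sigma> (tree_ball G n) then f \<zeta> else 0)"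
      using that by (intro sum.cong) (auto simp: indicator_def)
    then show ?thesis
      using fin restrict_configs[OF that tree_ball_verts] by simp
  qed
  have int: "integrable \<mu> (\<lambda>\<sigma>. f \<zeta> * indicator (?A \<zeta>) \<sigma>)" for \<zeta>
    using cylinder_sets by (intro integrable_mult_right integrable_real_indicator) (auto simp: emeasure_eq_measure)
  show "integrable \<mu> (\<lambda>\<sigma>. f (restrict \<sigma> (tree_ball G n)))"
    using int by (subst Bochner_Integration.integrable_cong[OF refl eq]) auto
  have "(\<integral>\<sigma>. f (restrict \<sigma> (tree_ball G n)) \<partial>\<mu>) = (\<Sum>\<zeta>\<in>?C. \<integral>\<sigma>. f \<zeta> * indicator (?A \<zeta>) \<sigma> \<partial>\<mu>)"
    using int by (subst Bochner_Integration.integral_cong[OF refl eq]) (auto intro: Bochner_Integration.integral_sum)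
  also have "\<dots> = (\<Sum>\<zeta>\<in>?C. f \<zeta> * measure \<mu> (?A \<zeta>))"
    using sets.sets_into_space[OF cylinder_sets] by (simp add: Int_absorb2)
  also have "\<dots> = (\<Sum>\<zeta>\<in>?C. mass n \<zeta> * f \<zeta>)"
    using sgm by (intro sum.cong) (simp_all add: splitting_gibbs_measure_def)
  finally show "(\<integral>\<sigma>. f (restrict \<sigma> (tree_ball G n)) \<partial>\<mu>) = (\<Sum>\<zeta>\<in>?C. mass n \<zeta> * f \<zeta>)" .
qed

end

section \<open>The DLR equations and conditioning on tail events\<close>

context splitting_measure
begin

abbreviation glue :: "'v set \<Rightarrow> ('v \<Rightarrow> real) \<Rightarrow> ('v \<Rightarrow> real) \<Rightarrow> 'v \<Rightarrow> real" where
  "glue \<Lambda> \<sigma> \<eta> \<equiv> merge \<Lambda> (verts G - \<Lambda>) (\<sigma>, \<eta>)"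

abbreviation gw :: "'v set \<Rightarrow> ('v \<Rightarrow> real) \<Rightarrow> real" where
  "gw \<equiv> gibbs_weight G J \<beta>"

lemma glue_space:
  assumes "\<Lambda> \<subseteq> verts G" "\<sigma> \<in> configs_on G \<Lambda>" "\<eta> \<in> space \<mu>"
  shows "glue \<Lambda> \<sigma> \<eta> \<in> space \<mu>"
  using assms by (auto simp: space_config configs_on_def merge_def PiE_iff extensional_def)

lemma glue_measurable:
  assumes "\<Lambda> \<subseteq> verts G" "\<sigma> \<in> configs_on G \<Lambda>"
  shows "glue \<Lambda> \<sigma> \<in> measurable \<mu> \<mu>"
proof -
  have "(\<lambda>\<eta> x. glue \<Lambda> \<sigma> \<eta> x) \<in> measurable \<mu> (config_space G)"
    unfolding config_space_def
  proof (rule measurable_PiM_single')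
    fix x assume x: "x \<in> verts G"
    show "(\<lambda>\<eta>. glue \<Lambda> \<sigma> \<eta> x) \<in> measurable \<mu> (count_space (spin_set G x))"
    proof (cases "x \<in> \<Lambda>")
      case True
      then have "\<sigma> x \<in> spin_set G x"
        using assms by (auto simp: configs_on_def)
      then show ?thesis
        using True by (simp add: merge_def)
    next
      case False
      then show ?thesis
        using spin_measurable[OF x] x by (simp add: merge_def)
    qed
  qed (use glue_space[OF assms] in \<open>auto simp: space_config configs_on_def\<close>)
  then show ?thesis
    by (simp add: measurable_cong_sets[OF refl sets_config])
qed

lemma gibbs_weight_local:
  assumes "\<Lambda> \<subseteq> tree_ball G n" "\<And>x. x \<in> tree_ball G (Suc n) \<Longrightarrow> \<xi> x = \<xi>' x"
  shows "gw \<Lambda> \<xi> = gw \<Lambda> \<xi>'"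
proof -
  have "energy J {e \<in> edges G. e \<inter> \<Lambda> \<noteq> {}} \<xi> = energy J {e \<in> edges G. e \<inter> \<Lambda> \<noteq> {}} \<xi>'"
    using edges_meeting_ball[OF assms(1)] assms(2)
    by (intro energy_cong) (auto simp: ball_edges_def subset_iff)
  then show ?thesis
    by (simp add: gibbs_weight_def)
qed

lemma gibbs_weight_pos: "gw \<Lambda> \<xi> > 0"
  by (simp add: gibbs_weight_def)

text \<open>Detailed balance: configurations that differ only inside \<open>\<Lambda>\<close> have the same boundary terms and the
same energy on the edges that avoid \<open>\<Lambda>\<close>. The ball must have radius \<open>n + 1\<close>, so that no vertex of
\<open>\<Lambda>\<close> lies on its boundary level.\<close>

lemma mass_exchange:
  assumes "\<Lambda> \<subseteq> tree_ball G n" and agree: "\<And>x. x \<notin> \<Lambda> \<Longrightarrow> \<xi> x = \<xi>' x"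
  shows "mass (Suc n) \<xi> * gw \<Lambda> \<xi>' = mass (Suc n) \<xi>' * gw \<Lambda> \<xi>"
proof -
  let ?E = "{e \<in> edges G. e \<inter> \<Lambda> \<noteq> {}}" and ?B = "ball_edges G (Suc n)"
  have sub: "?E \<subseteq> ?B"
    using assms by (intro edges_meeting_ball)
  have split: "energy J ?B \<zeta> = energy J ?E \<zeta> + energy J (?B - ?E) \<zeta>" for \<zeta>
    unfolding energy_def sum.subset_diff[OF sub finite_ball_edges] by (simp add: algebra_simps)
  have rest: "energy J (?B - ?E) \<xi> = energy J (?B - ?E) \<xi>'"
    using agree by (intro energy_cong) (auto simp: ball_edges_def)
  have lev: "(\<Sum>x\<in>level G (Suc n). h x (\<xi> x)) = (\<Sum>x\<in>level G (Suc n). h x (\<xi>' x))"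
    using agree assms(1) tree_ball_level_disjoint[of n] by (intro sum.cong refl) (metis disjoint_iff subsetD)
  have "sgm_weight G J \<beta> h (Suc n) \<xi> * gw \<Lambda> \<xi>' = sgm_weight G J \<beta> h (Suc n) \<xi>' * gw \<Lambda> \<xi>"
    unfolding sgm_weight_def gibbs_weight_def split rest lev
    by (simp add: algebra_simps flip: exp_add)
  then show ?thesis
    by (simp add: sgm_mass_def)
qed

text \<open>The finite-volume Gibbs kernel acting on functions of the spins in a ball, as a finite sum.\<close>

definition ball_kernel :: "nat \<Rightarrow> 'v set \<Rightarrow> (('v \<Rightarrow> real) \<Rightarrow> real) \<Rightarrow> ('v \<Rightarrow> real) \<Rightarrow> real" where
  "ball_kernel n \<Lambda> f \<zeta> =
     (\<Sum>\<sigma>\<in>configs_on G \<Lambda>. gw \<Lambda> (merge \<Lambda> (tree_ball G n - \<Lambda>) (\<sigma>, \<zeta>)) * f (merge \<Lambda> (tree_ball G n - \<Lambda>) (\<sigma>, \<zeta>))) /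
     (\<Sum>\<sigma>\<in>configs_on G \<Lambda>. gw \<Lambda> (merge \<Lambda> (tree_ball G n - \<Lambda>) (\<sigma>, \<zeta>)))"

text \<open>The DLR equation on a ball. For a fixed configuration outside \<open>\<Lambda>\<close> the double sum over the old
and the resampled configuration inside \<open>\<Lambda>\<close> is symmetrised by \<open>mass_exchange\<close>, after which the
normalising sum of the kernel cancels.\<close>

lemma ball_dlr:
  assumes \<Lambda>: "\<Lambda> \<subseteq> tree_ball G n"
  shows "(\<Sum>\<zeta>\<in>configs_on G (tree_ball G (Suc n)). mass (Suc n) \<zeta> * ball_kernel (Suc n) \<Lambda> f \<zeta>) =
         (\<Sum>\<zeta>\<in>configs_on G (tree_ball G (Suc n)). mass (Suc n) \<zeta> * f \<zeta>)"
proof -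
  let ?B = "tree_ball G (Suc n)" and ?M = "mass (Suc n)"
  let ?m = "\<lambda>\<sigma> \<tau>. merge \<Lambda> (?B - \<Lambda>) (\<sigma>, \<tau>)"
  let ?C = "configs_on G \<Lambda>"
  have fin: "finite ?C"
    using \<Lambda> finite_subset finite_tree_ball finite_configs_on by metis
  have B: "?B = \<Lambda> \<union> (?B - \<Lambda>)"
    using \<Lambda> tree_ball_Suc by auto
  have sum_B: "(\<Sum>\<zeta>\<in>configs_on G ?B. F \<zeta>) =
      (\<Sum>\<tau>\<in>configs_on G (?B - \<Lambda>). \<Sum>\<sigma>\<in>?C. F (?m \<sigma> \<tau>))" for F :: "('v \<Rightarrow> real) \<Rightarrow> real"
    unfolding configs_on_def by (subst B, subst sum_PiE_Un) (auto intro: sum.swap)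
  have idem: "?m \<sigma> (?m \<sigma>' \<tau>) = ?m \<sigma> \<tau>" for \<sigma> \<sigma>' \<tau>
    by (auto simp: merge_def)
  have pos: "(\<Sum>\<sigma>\<in>?C. gw \<Lambda> (?m \<sigma> \<tau>)) > 0" for \<tau>
    using fin by (intro sum_pos) (auto simp: gibbs_weight_pos configs_on_nonempty)
  have swap: "?M (?m \<sigma>' \<tau>) * gw \<Lambda> (?m \<sigma> \<tau>) = ?M (?m \<sigma> \<tau>) * gw \<Lambda> (?m \<sigma>' \<tau>)" for \<sigma> \<sigma>' \<tau>
    using \<Lambda> by (intro mass_exchange) (auto simp: merge_def)
  have inner: "(\<Sum>\<sigma>'\<in>?C. ?M (?m \<sigma>' \<tau>) * ball_kernel (Suc n) \<Lambda> f (?m \<sigma>' \<tau>)) = (\<Sum>\<sigma>\<in>?C. ?M (?m \<sigma> \<tau>) * f (?m \<sigma> \<tau>))"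
    for \<tau>
  proof -
    let ?Z = "\<Sum>\<sigma>\<in>?C. gw \<Lambda> (?m \<sigma> \<tau>)"
    have "(\<Sum>\<sigma>'\<in>?C. ?M (?m \<sigma>' \<tau>) * ball_kernel (Suc n) \<Lambda> f (?m \<sigma>' \<tau>)) =
        (\<Sum>\<sigma>'\<in>?C. \<Sum>\<sigma>\<in>?C. ?M (?m \<sigma>' \<tau>) * gw \<Lambda> (?m \<sigma> \<tau>) * f (?m \<sigma> \<tau>)) / ?Z"
      by (simp add: ball_kernel_def idem sum_distrib_left mult.assoc flip: sum_divide_distrib)
    also have "\<dots> = (\<Sum>\<sigma>'\<in>?C. \<Sum>\<sigma>\<in>?C. ?M (?m \<sigma> \<tau>) * gw \<Lambda> (?m \<sigma>' \<tau>) * f (?m \<sigma> \<tau>)) / ?Z"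
      by (simp only: swap)
    also have "\<dots> = (\<Sum>\<sigma>\<in>?C. ?M (?m \<sigma> \<tau>) * f (?m \<sigma> \<tau>)) * ?Z / ?Z"
      by (subst sum.swap, simp only: sum_product, simp only: mult_ac)
    finally show ?thesis
      using pos[of \<tau>] by simp
  qed
  show ?thesis
    unfolding sum_B inner ..
qed

lemma gibbs_kernel_eq:
  "gibbs_kernel G J \<beta> \<Lambda> \<eta> A =
     (\<Sum>\<sigma>\<in>configs_on G \<Lambda>. gw \<Lambda> (glue \<Lambda> \<sigma> \<eta>) * indicator A (glue \<Lambda> \<sigma> \<eta>)) /
     (\<Sum>\<sigma>\<in>configs_on G \<Lambda>. gw \<Lambda> (glue \<Lambda> \<sigma> \<eta>))"
  by (simp add: gibbs_kernel_def Let_def)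

lemma gibbs_normaliser_pos:
  "finite \<Lambda> \<Longrightarrow> (\<Sum>\<sigma>\<in>configs_on G \<Lambda>. gw \<Lambda> (glue \<Lambda> \<sigma> \<eta>)) > 0"
  by (intro sum_pos) (auto simp: gibbs_weight_pos configs_on_nonempty finite_configs_on)

lemma gibbs_kernel_nonneg: "gibbs_kernel G J \<beta> \<Lambda> \<eta> A \<ge> 0"
  unfolding gibbs_kernel_eq
  by (intro divide_nonneg_nonneg sum_nonneg mult_nonneg_nonneg) (auto simp: gibbs_weight_pos less_imp_le)

lemma gibbs_kernel_sums:
  assumes "disjoint_family A"
  shows "(\<lambda>i. gibbs_kernel G J \<beta> \<Lambda> \<eta> (A i)) sums gibbs_kernel G J \<beta> \<Lambda> \<eta> (\<Union>i. A i)"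
  unfolding gibbs_kernel_eq
  using assms by (intro sums_divide sums_sum sums_mult indicator_sums) (auto simp: disjoint_family_on_def)

lemma gibbs_kernel_compl:
  assumes "finite \<Lambda>" "\<Lambda> \<subseteq> verts G" "\<eta> \<in> space \<mu>"
  shows "gibbs_kernel G J \<beta> \<Lambda> \<eta> (space \<mu> - A) = 1 - gibbs_kernel G J \<beta> \<Lambda> \<eta> A"
proof -
  have "gw \<Lambda> (glue \<Lambda> \<sigma> \<eta>) * indicator (space \<mu> - A) (glue \<Lambda> \<sigma> \<eta>) =
      gw \<Lambda> (glue \<Lambda> \<sigma> \<eta>) - gw \<Lambda> (glue \<Lambda> \<sigma> \<eta>) * indicator A (glue \<Lambda> \<sigma> \<eta>)"
    if "\<sigma> \<in> configs_on G \<Lambda>" for \<sigma>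
    using glue_space[OF assms(2) that assms(3)] by (simp add: indicator_def)
  then show ?thesis
    using gibbs_normaliser_pos[OF assms(1), of \<eta>]
    by (simp add: gibbs_kernel_eq sum_subtractf diff_divide_distrib)
qed

lemma gibbs_kernel_le_1:
  assumes "finite \<Lambda>" "\<Lambda> \<subseteq> verts G" "\<eta> \<in> space \<mu>"
  shows "gibbs_kernel G J \<beta> \<Lambda> \<eta> A \<le> 1"
  using gibbs_kernel_compl[OF assms, of A] gibbs_kernel_nonneg[of \<Lambda> \<eta> "space \<mu> - A"] by simp

lemma gibbs_weight_measurable:
  assumes "finite \<Lambda>" "\<Lambda> \<subseteq> verts G"
  shows "gw \<Lambda> \<in> borel_measurable \<mu>"
proof -
  obtain n where n: "\<Lambda> \<subseteq> tree_ball G n"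
    using finite_subset_ball assms by metis
  have "gw \<Lambda> = (\<lambda>\<xi>. gw \<Lambda> (restrict \<xi> (tree_ball G (Suc n))))"
    using n by (intro ext gibbs_weight_local) auto
  then show ?thesis
    using cylinder_measurable by metis
qed

lemma gibbs_kernel_measurable:
  assumes "finite \<Lambda>" "\<Lambda> \<subseteq> verts G" "A \<in> sets \<mu>"
  shows "(\<lambda>\<eta>. gibbs_kernel G J \<beta> \<Lambda> \<eta> A) \<in> borel_measurable \<mu>"
proof -
  note [measurable] = assms(3)
  have w: "(\<lambda>\<eta>. gw \<Lambda> (glue \<Lambda> \<sigma> \<eta>)) \<in> borel_measurable \<mu>"
    and i: "(\<lambda>\<eta>. indicator A (glue \<Lambda> \<sigma> \<eta>) :: real) \<in> borel_measurable \<mu>"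
    if "\<sigma> \<in> configs_on G \<Lambda>" for \<sigma>
    using glue_measurable[OF assms(2) that] gibbs_weight_measurable[OF assms(1,2)]
    by (auto intro: measurable_compose)
  show ?thesis
    unfolding gibbs_kernel_eq
    by (intro borel_measurable_divide borel_measurable_sum borel_measurable_times w i)
qed

lemma gibbs_kernel_integrable:
  assumes "finite \<Lambda>" "\<Lambda> \<subseteq> verts G" "A \<in> sets \<mu>"
  shows "integrable \<mu> (\<lambda>\<eta>. gibbs_kernel G J \<beta> \<Lambda> \<eta> A)"
  using gibbs_kernel_le_1[OF assms(1,2)] gibbs_kernel_nonneg
  by (intro integrable_const_bound[where B = 1] gibbs_kernel_measurable assms) auto

definition cylinder :: "nat \<Rightarrow> ('v \<Rightarrow> real) \<Rightarrow> ('v \<Rightarrow> real) set" where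
  "cylinder n \<zeta> = {\<sigma> \<in> space \<mu>. restrict \<sigma> (tree_ball G n) = \<zeta>}"

text \<open>The empty set is included to make the family closed under intersection. Small radii are left out
because the DLR equation is first proved on balls that contain \<open>\<Lambda>\<close> in their interior.\<close>

definition cylinders_from :: "nat \<Rightarrow> ('v \<Rightarrow> real) set set" where
  "cylinders_from n = insert {} {cylinder m \<zeta> | m \<zeta>. m \<ge> n}"

lemma Int_stable_cylinders: "Int_stable (cylinders_from n)"
proof -
  have main: "cylinder l \<zeta> \<inter> cylinder m \<zeta>' \<in> cylinders_from n" if "n \<le> m" "l \<le> m" for l m \<zeta> \<zeta>'
  proof -
    have "restrict \<sigma> (tree_ball G l) = restrict (restrict \<sigma> (tree_ball G m)) (tree_ball G l)" for \<sigma> :: "'v \<Rightarrow> real"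
      using tree_ball_mono[OF that(2)] by (simp add: Int_absorb1)
    then have "cylinder l \<zeta> \<inter> cylinder m \<zeta>' = (if restrict \<zeta>' (tree_ball G l) = \<zeta> then cylinder m \<zeta>' else {})"
      unfolding cylinder_def by auto
    then show ?thesis
      using that by (auto simp: cylinders_from_def)
  qed
  show ?thesis
  proof (rule Int_stableI)
    fix a b assume ab: "a \<in> cylinders_from n" "b \<in> cylinders_from n"
    show "a \<inter> b \<in> cylinders_from n"
    proof (cases "a = {} \<or> b = {}")
      case True
      then show ?thesis by (auto simp: cylinders_from_def)
    next
      case False
      then obtain l \<zeta> m \<zeta>' where "a = cylinder l \<zeta>" "b = cylinder m \<zeta>'" "n \<le> l" "n \<le> m"
        using ab by (auto simp: cylinders_from_def)
      then show ?thesis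
        using main[of m l \<zeta> \<zeta>'] main[of l m \<zeta>' \<zeta>] by (cases "l \<le> m") (auto simp: Int_commute)
    qed
  qed
qed

lemma sets_cylinders: "sets \<mu> = sigma_sets (space \<mu>) (cylinders_from n)"
proof
  have "cylinders_from n \<subseteq> sets \<mu>"
    using cylinder_sets by (auto simp: cylinders_from_def cylinder_def)
  then show "sigma_sets (space \<mu>) (cylinders_from n) \<subseteq> sets \<mu>"
    by (rule sets.sigma_sets_subset)
next
  let ?S = "sigma (space \<mu>) (cylinders_from n)"
  have sub: "cylinders_from n \<subseteq> Pow (space \<mu>)"
    by (auto simp: cylinders_from_def cylinder_def)
  have gen: "{\<sigma> \<in> space \<mu>. \<sigma> x \<in> A} \<in> sets ?S" if x: "x \<in> verts G" for x A
  proof -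
    obtain m where m: "n \<le> m" "x \<in> tree_ball G m"
    proof
      show "n \<le> max n (depth G x)" "x \<in> tree_ball G (max n (depth G x))"
        using x by (auto simp: tree_ball_eq)
    qed
    let ?Z = "{\<zeta> \<in> configs_on G (tree_ball G m). \<zeta> x \<in> A}"
    have "{\<sigma> \<in> space \<mu>. \<sigma> x \<in> A} = (\<Union>\<zeta>\<in>?Z. cylinder m \<zeta>)"
      using m restrict_configs[OF _ tree_ball_verts, of _ m] by (auto simp: cylinder_def)
    also have "\<dots> \<in> sets ?S"
    proof (rule sets.finite_UN)
      show "finite ?Z"
        by (simp add: finite_configs_on finite_tree_ball)
      show "cylinder m \<zeta> \<in> sets ?S" for \<zeta>
        unfolding sets_measure_of[OF sub] using m
        by (intro sigma_sets.Basic) (auto simp: cylinders_from_def)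
    qed
    finally show ?thesis .
  qed
  have sp: "space \<mu> = (\<Pi>\<^sub>E i\<in>verts G. space (count_space (spin_set G i)))"
    by (simp add: space_config configs_on_def)
  have "sets \<mu> = sigma_sets (space \<mu>)
      {{\<sigma> \<in> space \<mu>. \<sigma> x \<in> A} | x A. x \<in> verts G \<and> A \<in> sets (count_space (spin_set G x))}"
    unfolding sets_config config_space_def sets_PiM_single sp ..
  also have "\<dots> \<subseteq> sets ?S"
  proof -
    have "{{\<sigma> \<in> space \<mu>. \<sigma> x \<in> A} | x A. x \<in> verts G \<and> A \<in> sets (count_space (spin_set G x))} \<subseteq> sets ?S"
      using gen by auto
    then show ?thesis
      using sets.sigma_sets_subset[of _ ?S] by (simp add: space_measure_of[OF sub])
  qed
  finally show "sets \<mu> \<subseteq> sigma_sets (space \<mu>) (cylinders_from n)"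
    using sub by simp
qed

lemma gibbs_kernel_cylinder:
  assumes \<Lambda>: "\<Lambda> \<subseteq> tree_ball G n" and \<eta>: "\<eta> \<in> space \<mu>"
  shows "gibbs_kernel G J \<beta> \<Lambda> \<eta> (cylinder (Suc n) \<zeta>) =
           ball_kernel (Suc n) \<Lambda> (\<lambda>\<xi>. of_bool (\<xi> = \<zeta>)) (restrict \<eta> (tree_ball G (Suc n)))"
proof -
  let ?B = "tree_ball G (Suc n)"
  have B: "\<Lambda> \<subseteq> ?B" "?B \<subseteq> verts G"
    using \<Lambda> tree_ball_mono[of n "Suc n"] tree_ball_verts[of "Suc n"] by auto
  have r: "restrict (glue \<Lambda> \<sigma> \<eta>) ?B = merge \<Lambda> (?B - \<Lambda>) (\<sigma>, restrict \<eta> ?B)" for \<sigma>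
    using B by (auto simp: merge_def restrict_def fun_eq_iff)
  have w: "gw \<Lambda> (glue \<Lambda> \<sigma> \<eta>) = gw \<Lambda> (merge \<Lambda> (?B - \<Lambda>) (\<sigma>, restrict \<eta> ?B))" for \<sigma>
    using \<Lambda> by (intro gibbs_weight_local) (auto simp flip: r)
  have i: "indicator (cylinder (Suc n) \<zeta>) (glue \<Lambda> \<sigma> \<eta>) =
      (of_bool (merge \<Lambda> (?B - \<Lambda>) (\<sigma>, restrict \<eta> ?B) = \<zeta>) :: real)" if "\<sigma> \<in> configs_on G \<Lambda>" for \<sigma>
    using glue_space[OF _ that \<eta>] B by (auto simp: cylinder_def r indicator_def)
  show ?thesis
    by (simp add: gibbs_kernel_eq ball_kernel_def w i cong: sum.cong)
qed

text \<open>Both sides of the DLR equation are countably additive in the event, so it passes from the cylinders,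
where it is \<open>ball_dlr\<close>, to the whole \<open>\<sigma>\<close>-algebra.\<close>

lemma gibbs_measure: "gibbs_measure G J \<beta> \<mu>"
  unfolding gibbs_measure_def
proof (intro conjI allI impI ballI)
  fix \<Lambda> A assume "finite \<Lambda> \<and> \<Lambda> \<subseteq> verts G" and A: "A \<in> sets \<mu>"
  then have \<Lambda>: "finite \<Lambda>" "\<Lambda> \<subseteq> verts G"
    by auto
  obtain n where n: "\<Lambda> \<subseteq> tree_ball G n"
    using finite_subset_ball \<Lambda> by metis
  let ?K = "\<lambda>A \<eta>. gibbs_kernel G J \<beta> \<Lambda> \<eta> A"
  have sets: "sets \<mu> = sigma_sets (space \<mu>) (cylinders_from (Suc n))"
    by (rule sets_cylinders)
  have sub: "cylinders_from (Suc n) \<subseteq> Pow (space \<mu>)"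
    by (auto simp: cylinders_from_def cylinder_def)
  show "measure \<mu> A = (\<integral>\<eta>. ?K A \<eta> \<partial>\<mu>)"
    using Int_stable_cylinders sub A[unfolded sets]
  proof (induction rule: sigma_sets_induct_disjoint)
    case empty
    then show ?case by (simp add: gibbs_kernel_eq)
  next
    case (compl A)
    then have A: "A \<in> sets \<mu>" by (simp add: sets)
    have "(\<integral>\<eta>. ?K (space \<mu> - A) \<eta> \<partial>\<mu>) = (\<integral>\<eta>. 1 - ?K A \<eta> \<partial>\<mu>)"
      using gibbs_kernel_compl[OF \<Lambda>] by (intro Bochner_Integration.integral_cong) auto
    also have "\<dots> = 1 - measure \<mu> A"
      using compl gibbs_kernel_integrable[OF \<Lambda> A] by (simp add: prob_space)
    finally show ?case
      using prob_compl[OF A] by simp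
  next
    case (union A)
    then have A: "A i \<in> sets \<mu>" for i
      unfolding sets by auto
    have sm: "(\<lambda>i. measure \<mu> (A i)) sums measure \<mu> (\<Union>i. A i)"
      using A union by (intro finite_measure_UNION) auto
    have k: "(\<lambda>i. ?K (A i) \<eta>) sums ?K (\<Union>i. A i) \<eta>" for \<eta>
      using union by (intro gibbs_kernel_sums)
    have "(\<lambda>i. \<integral>\<eta>. ?K (A i) \<eta> \<partial>\<mu>) sums (\<integral>\<eta>. (\<Sum>i. ?K (A i) \<eta>) \<partial>\<mu>)"
      using sm k union.IH by (intro sums_integral gibbs_kernel_integrable \<Lambda> A)
        (auto simp: gibbs_kernel_nonneg sums_iff)
    then have "(\<lambda>i. measure \<mu> (A i)) sums (\<integral>\<eta>. ?K (\<Union>i. A i) \<eta> \<partial>\<mu>)"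
      using union.IH by (simp add: sums_unique[OF k])
    then show ?case
      using sm sums_unique2 by blast
  next
    case (basic A)
    show ?case
    proof (cases "A = {}")
      case True
      then show ?thesis by (simp add: gibbs_kernel_eq)
    next
      case False
      then obtain m \<zeta> where m: "A = cylinder (Suc m) \<zeta>" "n \<le> m"
        using basic by (auto simp: cylinders_from_def Suc_le_D) (metis Suc_le_D Suc_le_mono)
      let ?C = "configs_on G (tree_ball G (Suc m))" and ?B = "tree_ball G (Suc m)"
      have \<Lambda>m: "\<Lambda> \<subseteq> tree_ball G m"
        using n tree_ball_mono[OF m(2)] by simp
      have "measure \<mu> A = (\<integral>\<sigma>. indicator A \<sigma> \<partial>\<mu>)"
        using sets.sets_into_space[OF cylinder_sets] by (simp add: m cylinder_def Int_absorb2)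
      also have "\<dots> = (\<integral>\<sigma>. of_bool (restrict \<sigma> ?B = \<zeta>) \<partial>\<mu>)"
        by (intro Bochner_Integration.integral_cong) (auto simp: m cylinder_def indicator_def)
      also have "\<dots> = (\<Sum>\<xi>\<in>?C. mass (Suc m) \<xi> * of_bool (\<xi> = \<zeta>))"
        by (rule cylinder_integral(2)[where f = "\<lambda>\<xi>. of_bool (\<xi> = \<zeta>)"])
      also have "\<dots> = (\<Sum>\<xi>\<in>?C. mass (Suc m) \<xi> * ball_kernel (Suc m) \<Lambda> (\<lambda>\<xi>. of_bool (\<xi> = \<zeta>)) \<xi>)"
        by (rule ball_dlr[OF \<Lambda>m, symmetric])
      also have "\<dots> = (\<integral>\<eta>. ball_kernel (Suc m) \<Lambda> (\<lambda>\<xi>. of_bool (\<xi> = \<zeta>)) (restrict \<eta> ?B) \<partial>\<mu>)"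
        by (rule cylinder_integral(2)[symmetric])
      also have "\<dots> = (\<integral>\<eta>. ?K A \<eta> \<partial>\<mu>)"
        by (intro Bochner_Integration.integral_cong) (simp_all add: m gibbs_kernel_cylinder[OF \<Lambda>m])
      finally show ?thesis .
    qed
  qed
qed (simp_all add: prob_space_axioms sets_config)

text \<open>Tail events in the form that the DLR equations use: events which do not notice a change of finitely
many spins.\<close>

definition tail_event :: "('v \<Rightarrow> real) set \<Rightarrow> bool" where
  "tail_event A \<longleftrightarrow> A \<in> sets \<mu> \<and> (\<forall>\<Lambda> \<sigma> \<eta>. finite \<Lambda> \<and> \<Lambda> \<subseteq> verts G \<and> \<sigma> \<in> configs_on G \<Lambda> \<and> \<eta> \<in> space \<mu> \<longrightarrow>
     (glue \<Lambda> \<sigma> \<eta> \<in> A \<longleftrightarrow> \<eta> \<in> A))"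

lemma tail_event_compl: "tail_event A \<Longrightarrow> tail_event (space \<mu> - A)"
  using glue_space by (auto simp: tail_event_def)

text \<open>Resampling inside \<open>\<Lambda>\<close> does not affect membership in a tail event, so its indicator passes through
the Gibbs kernel; the DLR equation for the conditioned measure is then the DLR equation of \<open>\<mu>\<close> for
\<open>A \<inter> B\<close>.\<close>

lemma gibbs_condition_tail:
  assumes A: "tail_event A" and pos: "measure \<mu> A > 0"
  shows "gibbs_measure G J \<beta> (uniform_measure \<mu> A)"
proof -
  have As: "A \<in> sets \<mu>" using A by (simp add: tail_event_def)
  have em: "emeasure \<mu> A \<noteq> 0" "emeasure \<mu> A \<noteq> \<infinity>"
    using pos by (auto simp: emeasure_eq_measure)
  have dens: "uniform_measure \<mu> A = density \<mu> (\<lambda>x. ennreal (indicator A x / measure \<mu> A))"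
    unfolding uniform_measure_def
  proof (rule arg_cong[where f = "density \<mu>"], rule ext)
    fix x
    show "indicator A x / emeasure \<mu> A = ennreal (indicator A x / measure \<mu> A)"
      using pos by (simp add: emeasure_eq_measure divide_ennreal flip: ennreal_indicator)
  qed
  have "measure (uniform_measure \<mu> A) B = (\<integral>\<eta>. gibbs_kernel G J \<beta> \<Lambda> \<eta> B \<partial>uniform_measure \<mu> A)"
    if \<Lambda>: "finite \<Lambda>" "\<Lambda> \<subseteq> verts G" and B: "B \<in> sets \<mu>" for \<Lambda> B
  proof -
    have tail: "indicator A \<eta> * gibbs_kernel G J \<beta> \<Lambda> \<eta> B = gibbs_kernel G J \<beta> \<Lambda> \<eta> (A \<inter> B)"
      if \<eta>: "\<eta> \<in> space \<mu>" for \<eta>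
    proof -
      have "glue \<Lambda> \<sigma> \<eta> \<in> A \<longleftrightarrow> \<eta> \<in> A" if "\<sigma> \<in> configs_on G \<Lambda>" for \<sigma>
        using A \<Lambda> \<eta> that by (auto simp: tail_event_def)
      then have "(indicator (A \<inter> B) (glue \<Lambda> \<sigma> \<eta>) :: real) = indicator A \<eta> * indicator B (glue \<Lambda> \<sigma> \<eta>)"
        if "\<sigma> \<in> configs_on G \<Lambda>" for \<sigma>
        using that by (simp add: indicator_inter_arith indicator_def)
      then show ?thesis
        by (simp add: gibbs_kernel_eq sum_distrib_left mult_ac cong: sum.cong)
    qed
    have "(\<integral>\<eta>. gibbs_kernel G J \<beta> \<Lambda> \<eta> B \<partial>uniform_measure \<mu> A) =
        (\<integral>\<eta>. (indicator A \<eta> / measure \<mu> A) *\<^sub>R gibbs_kernel G J \<beta> \<Lambda> \<eta> B \<partial>\<mu>)"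
      unfolding dens using As by (intro integral_density gibbs_kernel_measurable \<Lambda> B) auto
    also have "\<dots> = (\<integral>\<eta>. gibbs_kernel G J \<beta> \<Lambda> \<eta> (A \<inter> B) / measure \<mu> A \<partial>\<mu>)"
      by (intro Bochner_Integration.integral_cong) (simp_all flip: tail)
    also have "\<dots> = measure \<mu> (A \<inter> B) / measure \<mu> A"
      using gibbs_measure \<Lambda> As B by (simp add: gibbs_measure_def)
    finally show ?thesis
      using em B by simp
  qed
  then show ?thesis
    using prob_space_uniform_measure[OF em] by (auto simp: gibbs_measure_def sets_config)
qed

lemma non_extremal_if_tail_event:
  assumes A: "tail_event A" and "0 < measure \<mu> A" "measure \<mu> A < 1"
  shows "non_extremal_gibbs G J \<beta> \<mu>"
proof -
  let ?A' = "space \<mu> - A"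
  have As: "A \<in> sets \<mu>" using A by (simp add: tail_event_def)
  have m': "measure \<mu> ?A' = 1 - measure \<mu> A"
    by (rule prob_compl[OF As])
  have cond: "measure (uniform_measure \<mu> B) C = measure \<mu> (B \<inter> C) / measure \<mu> B"
    if "measure \<mu> B > 0" "C \<in> sets \<mu>" for B C
    using that by (intro measure_uniform_measure) (auto simp: emeasure_eq_measure)
  have "measure (uniform_measure \<mu> A) A = 1" "measure (uniform_measure \<mu> ?A') A = 0"
    using cond[of A A] cond[of ?A' A] assms As m' by (auto simp: Int_commute)
  then have "uniform_measure \<mu> A \<noteq> \<mu>" "uniform_measure \<mu> ?A' \<noteq> \<mu>"
    using assms by auto
  moreover have "measure \<mu> B = measure \<mu> A * measure (uniform_measure \<mu> A) B
      + (1 - measure \<mu> A) * measure (uniform_measure \<mu> ?A') B" if B: "B \<in> sets \<mu>" for B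
  proof -
    have "measure \<mu> B = measure \<mu> (A \<inter> B) + measure \<mu> (?A' \<inter> B)"
      using As B sets.sets_into_space[OF B]
      by (subst finite_measure_Union[symmetric]) (auto intro!: arg_cong[where f = "measure \<mu>"])
    then show ?thesis
      using cond[of A B] cond[of ?A' B] assms B m' by simp
  qed
  ultimately have "nontrivial_gibbs_mixture G J \<beta> \<mu>"
    unfolding nontrivial_gibbs_mixture_def
    using gibbs_condition_tail[OF A] gibbs_condition_tail[OF tail_event_compl[OF A]] assms m'
    by (intro exI[of _ "uniform_measure \<mu> A"] exI[of _ "uniform_measure \<mu> ?A'"] exI[of _ "measure \<mu> A"]) auto
  then show ?thesis
    using gibbs_measure by (simp add: non_extremal_gibbs_def extremal_gibbs_def)
qed

end

section \<open>A convergent martingale along the levels\<close>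

text \<open>Functions \<open>\<phi> n\<close> of the spins on level \<open>n\<close> that are carried to each other, up to the factors
\<open>c n\<close>, by the one-step transition laws. The levels are treated one at a time, which avoids
correlations between vertices with a common grandparent.\<close>

locale eigenfunction_system = splitting_measure G k J \<beta> h \<mu>
  for G :: "'v rooted_graph" and k J \<beta> h \<mu> +
  fixes \<phi> :: "nat \<Rightarrow> real \<Rightarrow> real" and c :: "nat \<Rightarrow> real" and C :: real
  assumes eigen: "\<And>n y s. y \<in> level G (Suc n) \<Longrightarrow> s \<in> spin_set G (parent G y) \<Longrightarrow>
      (\<Sum>t\<in>spin_set G y. transition y s t * \<phi> (Suc n) t) = c n * \<phi> n s"
    and c_nonzero: "\<And>n. c n \<noteq> 0"
    and bounded: "\<And>n t. \<bar>\<phi> n t\<bar> \<le> C"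
begin

definition growth :: "nat \<Rightarrow> real" where
  "growth n = (\<Prod>j<n. real k * c j)"

definition martingale :: "nat \<Rightarrow> ('v \<Rightarrow> real) \<Rightarrow> real" where
  "martingale n \<xi> = (\<Sum>x\<in>level G n. \<phi> n (\<xi> x)) / growth n"

definition increment :: "nat \<Rightarrow> ('v \<Rightarrow> real) \<Rightarrow> real" where
  "increment n \<xi> = martingale (Suc n) \<xi> - martingale n \<xi>"

lemma C_nonneg: "C \<ge> 0"
  using bounded[of 0 0] by linarith

text \<open>The part of the contribution of a vertex \<open>y\<close> that is not predicted by the spin of its parent.\<close>

definition innovation :: "nat \<Rightarrow> ('v \<Rightarrow> real) \<Rightarrow> 'v \<Rightarrow> real \<Rightarrow> real" where
  "innovation n \<zeta> y t = \<phi> (Suc n) t - c n * \<phi> n (\<zeta> (parent G y))"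

lemma increment_join:
  "increment n (join n \<zeta> \<omega>) = (\<Sum>y\<in>level G (Suc n). innovation n \<zeta> y (\<omega> y)) / growth (Suc n)"
proof -
  have "level G n \<subseteq> tree_ball G n" by (rule level_subset_ball)
  then have "(\<Sum>x\<in>level G n. \<phi> n (join n \<zeta> \<omega> x)) = (\<Sum>x\<in>level G n. \<phi> n (\<zeta> x))"
    by (intro sum.cong refl) (auto simp: join_ball)
  then have "martingale n (join n \<zeta> \<omega>) = c n * (\<Sum>y\<in>level G (Suc n). \<phi> n (\<zeta> (parent G y))) / growth (Suc n)"
    using k_pos c_nonzero[of n] sum_over_parents[of "\<lambda>x. \<phi> n (\<zeta> x)" n]
    by (simp add: martingale_def growth_def)
  moreover have "martingale (Suc n) (join n \<zeta> \<omega>) = (\<Sum>y\<in>level G (Suc n). \<phi> (Suc n) (\<omega> y)) / growth (Suc n)"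
    by (simp add: martingale_def join_level)
  ultimately show ?thesis
    by (simp add: increment_def innovation_def sum_subtractf sum_distrib_left diff_divide_distrib)
qed

lemma parent_spin:
  assumes "\<zeta> \<in> configs_on G (tree_ball G n)" "y \<in> level G (Suc n)"
  shows "\<zeta> (parent G y) \<in> spin_set G (parent G y)"
  using assms parent_edge(2)[OF assms(2)] level_subset_ball by (auto simp: configs_on_def)

lemma innovation_centred:
  assumes "\<zeta> \<in> configs_on G (tree_ball G n)" "y \<in> level G (Suc n)"
  shows "(\<Sum>t\<in>spin_set G y. transition y (\<zeta> (parent G y)) t * innovation n \<zeta> y t) = 0"
  using eigen[OF assms(2) parent_spin[OF assms]]
  by (simp add: innovation_def right_diff_distrib sum_subtractf transition_sum flip: sum_distrib_right)

lemma innovation_variance: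
  assumes "\<zeta> \<in> configs_on G (tree_ball G n)" "y \<in> level G (Suc n)"
  shows "(\<Sum>t\<in>spin_set G y. transition y (\<zeta> (parent G y)) t * (innovation n \<zeta> y t)\<^sup>2) \<le> C\<^sup>2"
proof -
  let ?p = "transition y (\<zeta> (parent G y))" and ?a = "c n * \<phi> n (\<zeta> (parent G y))"
  have "(\<Sum>t\<in>spin_set G y. ?p t * (\<phi> (Suc n) t)\<^sup>2) =
      (\<Sum>t\<in>spin_set G y. ?p t * (innovation n \<zeta> y t)\<^sup>2 + 2 * ?a * (?p t * innovation n \<zeta> y t) + ?a\<^sup>2 * ?p t)"
    by (intro sum.cong refl) (simp add: innovation_def power2_eq_square algebra_simps)
  also have "\<dots> = (\<Sum>t\<in>spin_set G y. ?p t * (innovation n \<zeta> y t)\<^sup>2) + ?a\<^sup>2"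
    by (simp add: sum.distrib innovation_centred[OF assms] transition_sum flip: sum_distrib_left)
  finally have "(\<Sum>t\<in>spin_set G y. ?p t * (innovation n \<zeta> y t)\<^sup>2) \<le> (\<Sum>t\<in>spin_set G y. ?p t * (\<phi> (Suc n) t)\<^sup>2)"
    by simp
  also have "\<dots> \<le> (\<Sum>t\<in>spin_set G y. ?p t * C\<^sup>2)"
    using bounded C_nonneg
    by (intro sum_mono mult_left_mono transition_nonneg) (simp add: abs_le_square_iff[symmetric])
  finally show ?thesis
    by (simp add: transition_sum flip: sum_distrib_right)
qed

lemma martingale_local: "martingale n \<sigma> = martingale n (restrict \<sigma> (tree_ball G m))" if "n \<le> m"
  using level_subset_ball[of n] tree_ball_mono[OF that]
  unfolding martingale_def by (intro arg_cong2[where f = "(/)"] sum.cong refl) auto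

lemma increment_local: "increment n \<sigma> = increment n (restrict \<sigma> (tree_ball G (Suc n)))"
  unfolding increment_def using martingale_local[of "Suc n" "Suc n" \<sigma>] martingale_local[of n "Suc n" \<sigma>] by simp

lemma origin_ball: "origin G \<in> tree_ball G n"
  using tree_ball_mono[of 0 n] by (simp add: tree_ball_0)

text \<open>Conditionally on the spins up to level \<open>n\<close> the increment has mean zero, since each of its terms
has. The root is one of those spins.\<close>

lemma increment_orthogonal_root:
  fixes g :: "real \<Rightarrow> real"
  shows "(\<integral>\<sigma>. increment n \<sigma> * g (\<sigma> (origin G)) \<partial>\<mu>) = 0"
proof -
  let ?W = "\<lambda>\<zeta> \<omega>. \<Prod>y\<in>level G (Suc n). transition y (\<zeta> (parent G y)) (\<omega> y)"
  have cond: "(\<Sum>\<omega>\<in>configs_on G (level G (Suc n)). ?W \<zeta> \<omega> * increment n (join n \<zeta> \<omega>)) = 0"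
    if \<zeta>: "\<zeta> \<in> configs_on G (tree_ball G n)" for \<zeta>
  proof -
    have "(\<Sum>\<omega>\<in>configs_on G (level G (Suc n)). ?W \<zeta> \<omega> * increment n (join n \<zeta> \<omega>)) =
        (\<Sum>y\<in>level G (Suc n). \<Sum>\<omega>\<in>configs_on G (level G (Suc n)). ?W \<zeta> \<omega> * innovation n \<zeta> y (\<omega> y)) / growth (Suc n)"
      by (subst sum.swap) (simp add: increment_join sum_distrib_left sum_divide_distrib)
    also have "\<dots> = (\<Sum>y\<in>level G (Suc n). \<Sum>t\<in>spin_set G y. transition y (\<zeta> (parent G y)) t * innovation n \<zeta> y t) / growth (Suc n)"
      unfolding configs_on_def
      by (intro arg_cong2[where f = "(/)"] sum.cong refl
          product_weight_expectation_one[where p = "\<lambda>y. transition y (\<zeta> (parent G y))" and f = "innovation n \<zeta>"])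
        (auto simp: finite_level finite_spin_set transition_sum)
    also have "\<dots> = 0"
      using innovation_centred[OF \<zeta>] by simp
    finally show ?thesis .
  qed
  have "(\<integral>\<sigma>. increment n \<sigma> * g (\<sigma> (origin G)) \<partial>\<mu>) =
      (\<integral>\<sigma>. (\<lambda>\<xi>. increment n \<xi> * g (\<xi> (origin G))) (restrict \<sigma> (tree_ball G (Suc n))) \<partial>\<mu>)"
    using increment_local[of n] by (simp add: origin_ball)
  also have "\<dots> = (\<Sum>\<xi>\<in>configs_on G (tree_ball G (Suc n)). mass (Suc n) \<xi> * (increment n \<xi> * g (\<xi> (origin G))))"
    by (rule cylinder_integral(2))
  also have "\<dots> = (\<Sum>\<zeta>\<in>configs_on G (tree_ball G n). mass n \<zeta> * (g (\<zeta> (origin G)) *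
      (\<Sum>\<omega>\<in>configs_on G (level G (Suc n)). ?W \<zeta> \<omega> * increment n (join n \<zeta> \<omega>))))"
    unfolding expectation_step by (simp add: join_ball origin_ball sum_distrib_left mult_ac)
  also have "\<dots> = 0"
    by (simp add: cond)
  finally show ?thesis .
qed

text \<open>Given the earlier spins the innovations are independent and centred, so their variances add up, and
there are \<open>k ^ (n + 1)\<close> of them.\<close>

lemma increment_second_moment: "(\<integral>\<sigma>. (increment n \<sigma>)\<^sup>2 \<partial>\<mu>) \<le> C\<^sup>2 * real k ^ Suc n / (growth (Suc n))\<^sup>2"
proof -
  let ?W = "\<lambda>\<zeta> \<omega>. \<Prod>y\<in>level G (Suc n). transition y (\<zeta> (parent G y)) (\<omega> y)"
  have cond: "(\<Sum>\<omega>\<in>configs_on G (level G (Suc n)). ?W \<zeta> \<omega> * (increment n (join n \<zeta> \<omega>))\<^sup>2) \<le>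
      C\<^sup>2 * real k ^ Suc n / (growth (Suc n))\<^sup>2"
    if \<zeta>: "\<zeta> \<in> configs_on G (tree_ball G n)" for \<zeta>
  proof -
    have "(\<Sum>\<omega>\<in>configs_on G (level G (Suc n)). ?W \<zeta> \<omega> * (increment n (join n \<zeta> \<omega>))\<^sup>2) =
        (\<Sum>\<omega>\<in>configs_on G (level G (Suc n)). ?W \<zeta> \<omega> * (\<Sum>y\<in>level G (Suc n). innovation n \<zeta> y (\<omega> y))\<^sup>2) / (growth (Suc n))\<^sup>2"
      unfolding increment_join power_divide times_divide_eq_right by (simp flip: sum_divide_distrib)
    also have "\<dots> = (\<Sum>y\<in>level G (Suc n). \<Sum>t\<in>spin_set G y. transition y (\<zeta> (parent G y)) t * (innovation n \<zeta> y t)\<^sup>2) / (growth (Suc n))\<^sup>2"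
      unfolding configs_on_def
      by (intro arg_cong2[where f = "(/)"] refl product_weight_sum_square innovation_centred[OF \<zeta>])
        (auto simp: finite_level finite_spin_set transition_sum)
    also have "\<dots> \<le> (\<Sum>y\<in>level G (Suc n). C\<^sup>2) / (growth (Suc n))\<^sup>2"
      by (intro divide_right_mono sum_mono innovation_variance[OF \<zeta>]) auto
    finally show ?thesis
      by (simp add: card_level del: power_Suc) (simp add: mult_ac)
  qed
  have total: "(\<Sum>\<zeta>\<in>configs_on G (tree_ball G n). mass n \<zeta>) = 1"
    using cylinder_integral(2)[of "\<lambda>_. 1" n] by (simp add: prob_space)
  have "(\<integral>\<sigma>. (increment n \<sigma>)\<^sup>2 \<partial>\<mu>) = (\<integral>\<sigma>. (\<lambda>\<xi>. (increment n \<xi>)\<^sup>2) (restrict \<sigma> (tree_ball G (Suc n))) \<partial>\<mu>)"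
    using increment_local[of n] by simp
  also have "\<dots> = (\<Sum>\<xi>\<in>configs_on G (tree_ball G (Suc n)). mass (Suc n) \<xi> * (increment n \<xi>)\<^sup>2)"
    by (rule cylinder_integral(2))
  also have "\<dots> \<le> (\<Sum>\<zeta>\<in>configs_on G (tree_ball G n). mass n \<zeta> * (C\<^sup>2 * real k ^ Suc n / (growth (Suc n))\<^sup>2))"
    unfolding expectation_step
    by (intro sum_mono mult_left_mono cond) (auto simp: mass_pos less_imp_le)
  finally show ?thesis
    unfolding sum_distrib_right[symmetric] total by simp
qed

lemma martingale_measurable [measurable]: "martingale n \<in> borel_measurable \<mu>"
proof -
  have "martingale n = (\<lambda>\<sigma>. martingale n (restrict \<sigma> (tree_ball G n)))"
    using martingale_local[of n n] by auto
  then show ?thesis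
    using cylinder_measurable by metis
qed

lemma increment_measurable [measurable]: "increment n \<in> borel_measurable \<mu>"
  unfolding increment_def by measurable

lemma cylinder_function_integrable:
  fixes f :: "('v \<Rightarrow> real) \<Rightarrow> real"
  assumes "\<And>\<sigma>. f \<sigma> = f (restrict \<sigma> (tree_ball G n))"
  shows "integrable \<mu> f"
proof -
  have "f = (\<lambda>\<sigma>. f (restrict \<sigma> (tree_ball G n)))"
    using assms by auto
  then show ?thesis
    using cylinder_integral(1) by metis
qed

lemma increment_integrable: "integrable \<mu> (\<lambda>\<sigma>. F (increment n \<sigma>) * g (\<sigma> (origin G)))" for F g :: "real \<Rightarrow> real"
  using increment_local[of n] by (intro cylinder_function_integrable[of _ "Suc n"]) (simp add: origin_ball)

lemma increment_first_moment: "(\<integral>\<sigma>. \<bar>increment n \<sigma>\<bar> \<partial>\<mu>) \<le> C * sqrt (real k ^ Suc n) / \<bar>growth (Suc n)\<bar>"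
proof -
  have int: "integrable \<mu> (\<lambda>\<sigma>. \<bar>increment n \<sigma>\<bar>)" "integrable \<mu> (\<lambda>\<sigma>. \<bar>increment n \<sigma>\<bar>\<^sup>2)"
    using increment_integrable[of abs n "\<lambda>_. 1"] increment_integrable[of "\<lambda>x. \<bar>x\<bar>\<^sup>2" n "\<lambda>_. 1"] by simp_all
  have "(\<integral>\<sigma>. \<bar>increment n \<sigma>\<bar> \<partial>\<mu>)\<^sup>2 \<le> (\<integral>\<sigma>. (increment n \<sigma>)\<^sup>2 \<partial>\<mu>)"
    using variance_eq[OF int] variance_positive[of "\<lambda>\<sigma>. \<bar>increment n \<sigma>\<bar>"] by simp
  also have "\<dots> \<le> C\<^sup>2 * real k ^ Suc n / (growth (Suc n))\<^sup>2"
    by (rule increment_second_moment)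
  also have "\<dots> = (C * sqrt (real k ^ Suc n) / \<bar>growth (Suc n)\<bar>)\<^sup>2"
    by (simp add: power_divide power_mult_distrib)
  finally show ?thesis
    by (rule power2_le_imp_le) (simp add: C_nonneg)
qed

text \<open>Taking \<open>lim\<close> at every configuration, also where the sequence diverges, makes the invariance under
finite changes hold without exceptional sets.\<close>

definition tail_limit :: "('v \<Rightarrow> real) \<Rightarrow> real" where
  "tail_limit \<sigma> = lim (\<lambda>n. martingale n \<sigma>)"

lemma tail_limit_measurable [measurable]: "tail_limit \<in> borel_measurable \<mu>"
  unfolding tail_limit_def by measurable

lemma tail_limit_glue:
  assumes "finite \<Lambda>" "\<Lambda> \<subseteq> verts G"
  shows "tail_limit (glue \<Lambda> \<sigma> \<eta>) = tail_limit \<eta>"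
proof -
  obtain m where m: "\<Lambda> \<subseteq> tree_ball G m"
    using finite_subset_ball assms by metis
  have "martingale n (glue \<Lambda> \<sigma> \<eta>) = martingale n \<eta>" if "n > m" for n
  proof -
    have "glue \<Lambda> \<sigma> \<eta> x = \<eta> x" if "x \<in> level G n" for x
      using that m \<open>n > m\<close> by (auto simp: merge_def level_eq tree_ball_eq)
    then show ?thesis
      by (simp add: martingale_def)
  qed
  then have ev: "\<forall>\<^sub>F n in sequentially. martingale n (glue \<Lambda> \<sigma> \<eta>) = martingale n \<eta>"
    by (rule eventually_mono[OF eventually_gt_at_top[of m]])
  show ?thesis
    unfolding tail_limit_def lim_def tendsto_cong[OF ev] ..
qed

lemma tail_event_tail_limit: "tail_event {\<sigma> \<in> space \<mu>. tail_limit \<sigma> > a}"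
  unfolding tail_event_def using glue_space by (auto simp: tail_limit_glue)

context
  assumes summable_growth: "summable (\<lambda>n. sqrt (real k ^ n) / \<bar>growth n\<bar>)"
begin

lemma summable_increment_moments: "summable (\<lambda>n. \<integral>\<sigma>. \<bar>increment n \<sigma>\<bar> \<partial>\<mu>)"
proof (rule summable_comparison_test')
  show "summable (\<lambda>n. C * (sqrt (real k ^ Suc n) / \<bar>growth (Suc n)\<bar>))"
    using summable_growth by (intro summable_mult) (subst summable_Suc_iff)
  show "norm (\<integral>\<sigma>. \<bar>increment n \<sigma>\<bar> \<partial>\<mu>) \<le> C * (sqrt (real k ^ Suc n) / \<bar>growth (Suc n)\<bar>)" if "n \<ge> 0" for n
    using increment_first_moment[of n] by simp
qed

lemma increment_summable_AE: "AE \<sigma> in \<mu>. summable (\<lambda>n. \<bar>increment n \<sigma>\<bar>)"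
proof -
  have int: "integrable \<mu> (\<lambda>\<sigma>. \<bar>increment n \<sigma>\<bar>)" for n
    using increment_integrable[of abs n "\<lambda>_. 1"] by simp
  have "(\<integral>\<^sup>+\<sigma>. (\<Sum>n. ennreal \<bar>increment n \<sigma>\<bar>) \<partial>\<mu>) = (\<Sum>n. \<integral>\<^sup>+\<sigma>. ennreal \<bar>increment n \<sigma>\<bar> \<partial>\<mu>)"
    by (rule nn_integral_suminf) measurable
  also have "\<dots> = (\<Sum>n. ennreal (\<integral>\<sigma>. \<bar>increment n \<sigma>\<bar> \<partial>\<mu>))"
    by (intro arg_cong[where f = suminf] ext nn_integral_eq_integral int) auto
  also have "\<dots> \<noteq> \<infinity>"
    using summable_increment_moments by (simp add: ennreal_suminf_neq_top)
  finally have "AE \<sigma> in \<mu>. (\<Sum>n. ennreal \<bar>increment n \<sigma>\<bar>) \<noteq> \<infinity>"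
    by (intro nn_integral_PInf_AE) measurable
  then show ?thesis
    by (rule eventually_mono) (auto intro: summable_suminf_not_top)
qed

lemma tail_limit_AE: "AE \<sigma> in \<mu>. tail_limit \<sigma> = martingale 0 \<sigma> + (\<Sum>n. increment n \<sigma>)"
  using increment_summable_AE
proof (rule eventually_mono)
  fix \<sigma> assume "summable (\<lambda>n. \<bar>increment n \<sigma>\<bar>)"
  then have "summable (\<lambda>n. increment n \<sigma>)"
    by (rule summable_rabs_cancel)
  then have "(\<lambda>n. martingale 0 \<sigma> + (\<Sum>i<n. increment i \<sigma>)) \<longlonglongrightarrow> martingale 0 \<sigma> + (\<Sum>n. increment n \<sigma>)"
    by (intro tendsto_intros summable_LIMSEQ)
  moreover have "martingale 0 \<sigma> + (\<Sum>i<n. increment i \<sigma>) = martingale n \<sigma>" for n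
    by (induction n) (simp_all add: increment_def)
  ultimately show "tail_limit \<sigma> = martingale 0 \<sigma> + (\<Sum>n. increment n \<sigma>)"
    unfolding tail_limit_def by (intro limI) simp
qed

text \<open>The limit is the root term plus the sum of the increments. The sum may be integrated term by term,
and each increment is orthogonal to functions of the root spin. Hence the limit has the same
correlations with the root spin as \<open>\<phi> 0\<close>.\<close>

lemma tail_limit_root:
  fixes g :: "real \<Rightarrow> real"
  assumes g: "\<And>s. \<bar>g s\<bar> \<le> 1"
  shows "integrable \<mu> (\<lambda>\<sigma>. tail_limit \<sigma> * g (\<sigma> (origin G)))"
    and "(\<integral>\<sigma>. tail_limit \<sigma> * g (\<sigma> (origin G)) \<partial>\<mu>) = (\<integral>\<sigma>. \<phi> 0 (\<sigma> (origin G)) * g (\<sigma> (origin G)) \<partial>\<mu>)"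
proof -
  let ?g = "\<lambda>\<sigma>. g (\<sigma> (origin G))"
  have M0: "martingale 0 \<sigma> = \<phi> 0 (\<sigma> (origin G))" for \<sigma>
    by (simp add: martingale_def level_0 growth_def)
  have le: "\<bar>x * g s\<bar> \<le> \<bar>x\<bar>" for x s
    using mult_left_mono[OF g[of s], of "\<bar>x\<bar>"] by (simp add: abs_mult)
  have int: "integrable \<mu> (\<lambda>\<sigma>. increment n \<sigma> * ?g \<sigma>)" for n
    using increment_integrable[of "\<lambda>x. x" n g] by simp
  have int': "integrable \<mu> (\<lambda>\<sigma>. \<bar>increment n \<sigma>\<bar>)" "integrable \<mu> (\<lambda>\<sigma>. \<bar>increment n \<sigma> * ?g \<sigma>\<bar>)" for n
    using increment_integrable[of abs n "\<lambda>_. 1"] int by simp_all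
  have ae: "AE \<sigma> in \<mu>. summable (\<lambda>n. norm (increment n \<sigma> * ?g \<sigma>))"
    using increment_summable_AE
  proof (rule eventually_mono)
    show "summable (\<lambda>n. norm (increment n \<sigma> * ?g \<sigma>))" if "summable (\<lambda>n. \<bar>increment n \<sigma>\<bar>)" for \<sigma>
      using le[of "increment n \<sigma>" "\<sigma> (origin G)" for n] by (intro summable_comparison_test'[OF that]) simp
  qed
  have sm: "summable (\<lambda>n. \<integral>\<sigma>. norm (increment n \<sigma> * ?g \<sigma>) \<partial>\<mu>)"
  proof (rule summable_comparison_test'[OF summable_increment_moments])
    fix n :: nat assume "n \<ge> 0"
    show "norm (\<integral>\<sigma>. norm (increment n \<sigma> * ?g \<sigma>) \<partial>\<mu>) \<le> (\<integral>\<sigma>. \<bar>increment n \<sigma>\<bar> \<partial>\<mu>)"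
      using le int' by (auto intro!: integral_mono simp: integral_nonneg_AE)
  qed
  have int0: "integrable \<mu> (\<lambda>\<sigma>. martingale 0 \<sigma> * ?g \<sigma>)"
    by (intro cylinder_function_integrable[of _ 0]) (simp add: M0 origin_ball)
  have ints: "integrable \<mu> (\<lambda>\<sigma>. \<Sum>n. increment n \<sigma> * ?g \<sigma>)"
    by (rule integrable_suminf[OF int ae sm])
  have zero: "(\<integral>\<sigma>. (\<Sum>n. increment n \<sigma> * ?g \<sigma>) \<partial>\<mu>) = 0"
    by (simp add: integral_suminf[OF int ae sm] increment_orthogonal_root)
  have eq: "AE \<sigma> in \<mu>. tail_limit \<sigma> * ?g \<sigma> = martingale 0 \<sigma> * ?g \<sigma> + (\<Sum>n. increment n \<sigma> * ?g \<sigma>)"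
    using tail_limit_AE increment_summable_AE
  proof eventually_elim
    case (elim \<sigma>)
    then show ?case
      by (simp add: distrib_right suminf_mult2 summable_rabs_cancel)
  qed
  have gm: "?g \<in> borel_measurable \<mu>"
    by (rule spin_borel_measurable[OF origin_vert])
  have meas: "(\<lambda>\<sigma>. tail_limit \<sigma> * ?g \<sigma>) \<in> borel_measurable \<mu>"
    using gm by measurable
  have int_sum: "integrable \<mu> (\<lambda>\<sigma>. martingale 0 \<sigma> * ?g \<sigma> + (\<Sum>n. increment n \<sigma> * ?g \<sigma>))"
    using int0 ints by (rule Bochner_Integration.integrable_add)
  show "integrable \<mu> (\<lambda>\<sigma>. tail_limit \<sigma> * ?g \<sigma>)"
    using int_sum by (rule integrable_cong_AE_imp) (use meas eq in auto)
  have "(\<integral>\<sigma>. tail_limit \<sigma> * ?g \<sigma> \<partial>\<mu>) = (\<integral>\<sigma>. martingale 0 \<sigma> * ?g \<sigma> + (\<Sum>n. increment n \<sigma> * ?g \<sigma>) \<partial>\<mu>)"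
    using meas int_sum eq by (intro integral_cong_AE) auto
  also have "\<dots> = (\<integral>\<sigma>. \<phi> 0 (\<sigma> (origin G)) * ?g \<sigma> \<partial>\<mu>)"
    using int0 ints by (simp add: zero M0)
  finally show "(\<integral>\<sigma>. tail_limit \<sigma> * ?g \<sigma> \<partial>\<mu>) = (\<integral>\<sigma>. \<phi> 0 (\<sigma> (origin G)) * ?g \<sigma> \<partial>\<mu>)" .
qed

lemma root_spin_positive:
  assumes "s \<in> spin_set G (origin G)"
  shows "(\<integral>\<sigma>. of_bool (\<sigma> (origin G) = s) \<partial>\<mu>) > (0 :: real)"
proof -
  let ?C = "configs_on G (tree_ball G 0)"
  let ?\<zeta> = "restrict (\<lambda>_. s) {origin G}"
  have "(\<integral>\<sigma>. of_bool (\<sigma> (origin G) = s) \<partial>\<mu>) =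
      (\<integral>\<sigma>. (\<lambda>\<xi>. of_bool (\<xi> (origin G) = s)) (restrict \<sigma> (tree_ball G 0)) \<partial>\<mu>)"
    by (simp add: origin_ball)
  also have "\<dots> = (\<Sum>\<zeta>\<in>?C. mass 0 \<zeta> * of_bool (\<zeta> (origin G) = s))"
    by (rule cylinder_integral(2))
  also have "\<dots> > 0"
  proof (rule sum_pos2[where i = ?\<zeta>])
    show "finite ?C"
      by (simp add: finite_configs_on finite_tree_ball)
    show "?\<zeta> \<in> ?C"
      using assms by (simp add: tree_ball_0 configs_on_def)
  qed (auto simp: mass_pos less_imp_le)
  finally show ?thesis .
qed

text \<open>If the limit were almost surely equal to its mean, correlating it with the indicator of a root spin
\<open>s\<close>, which has positive probability, would give that \<open>\<phi> 0 s\<close> is this mean for every \<open>s\<close>. So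
the limit lies on both sides of its mean with positive probability.\<close>

theorem non_extremal_if_summable:
  assumes st: "s \<in> spin_set G (origin G)" "t \<in> spin_set G (origin G)" "\<phi> 0 s \<noteq> \<phi> 0 t"
  shows "non_extremal_gibbs G J \<beta> \<mu>"
proof -
  define m where "m = (\<integral>\<sigma>. \<phi> 0 (\<sigma> (origin G)) \<partial>\<mu>)"
  have int: "integrable \<mu> tail_limit" and mean: "(\<integral>\<sigma>. tail_limit \<sigma> \<partial>\<mu>) = m"
    using tail_limit_root[of "\<lambda>_. 1"] by (simp_all add: m_def)
  have root: "\<phi> 0 s = m" if ae: "AE \<sigma> in \<mu>. tail_limit \<sigma> = m" and s: "s \<in> spin_set G (origin G)" for s
  proof -
    let ?p = "\<integral>\<sigma>. of_bool (\<sigma> (origin G) = s) \<partial>\<mu> :: real"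
    have [measurable]: "(\<lambda>\<sigma>. of_bool (\<sigma> (origin G) = s) :: real) \<in> borel_measurable \<mu>"
      by (rule spin_borel_measurable[OF origin_vert])
    have "\<phi> 0 s * ?p = (\<integral>\<sigma>. \<phi> 0 s * of_bool (\<sigma> (origin G) = s) \<partial>\<mu>)"
      by simp
    also have "\<dots> = (\<integral>\<sigma>. \<phi> 0 (\<sigma> (origin G)) * of_bool (\<sigma> (origin G) = s) \<partial>\<mu>)"
      by (intro Bochner_Integration.integral_cong) auto
    also have "\<dots> = (\<integral>\<sigma>. tail_limit \<sigma> * of_bool (\<sigma> (origin G) = s) \<partial>\<mu>)"
      by (rule tail_limit_root(2)[symmetric]) simp
    also have "\<dots> = (\<integral>\<sigma>. m * of_bool (\<sigma> (origin G) = s) \<partial>\<mu>)"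
      using ae by (intro integral_cong_AE) (auto elim: eventually_mono)
    finally show ?thesis
      using root_spin_positive[OF s] by simp
  qed
  have not_const: "\<not> (AE \<sigma> in \<mu>. tail_limit \<sigma> = m)"
    using root st by metis
  let ?A = "{\<sigma> \<in> space \<mu>. tail_limit \<sigma> > m}"
  have A: "?A \<in> sets \<mu>"
    by measurable
  \<comment> \<open>a random variable that stays on one side of its mean is almost surely equal to it\<close>
  have one_sided: "AE \<sigma> in \<mu>. tail_limit \<sigma> = m"
    if "(AE \<sigma> in \<mu>. 0 \<le> tail_limit \<sigma> - m) \<or> (AE \<sigma> in \<mu>. 0 \<le> m - tail_limit \<sigma>)"
    using that
  proof
    assume "AE \<sigma> in \<mu>. 0 \<le> tail_limit \<sigma> - m"
    then have "AE \<sigma> in \<mu>. tail_limit \<sigma> - m = 0"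
      using int mean by (subst integral_nonneg_eq_0_iff_AE[symmetric]) (auto simp: prob_space)
    then show ?thesis by (auto elim: eventually_mono)
  next
    assume "AE \<sigma> in \<mu>. 0 \<le> m - tail_limit \<sigma>"
    then have "AE \<sigma> in \<mu>. m - tail_limit \<sigma> = 0"
      using int mean by (subst integral_nonneg_eq_0_iff_AE[symmetric]) (auto simp: prob_space)
    then show ?thesis by (auto elim: eventually_mono)
  qed
  have "measure \<mu> ?A \<noteq> 0"
  proof
    assume "measure \<mu> ?A = 0"
    then have "AE \<sigma> in \<mu>. \<not> tail_limit \<sigma> > m"
      using A by (subst AE_iff_measurable[of ?A]) (auto simp: emeasure_eq_measure)
    then have "AE \<sigma> in \<mu>. 0 \<le> m - tail_limit \<sigma>"
      by (auto elim: eventually_mono)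
    then show False
      using one_sided not_const by blast
  qed
  moreover have "measure \<mu> ?A \<noteq> 1"
  proof
    assume "measure \<mu> ?A = 1"
    then have "AE \<sigma> in \<mu>. \<sigma> \<in> ?A"
      using A by (simp add: prob_eq_1)
    then have "AE \<sigma> in \<mu>. 0 \<le> tail_limit \<sigma> - m"
      by (auto elim: eventually_mono)
    then show False
      using one_sided not_const by blast
  qed
  ultimately have "0 < measure \<mu> ?A" "measure \<mu> ?A < 1"
    using measure_nonneg[of \<mu> ?A] prob_le_1[of ?A] by linarith+
  then show ?thesis
    by (rule non_extremal_if_tail_event[OF tail_event_tail_limit])
qed

end

end

section \<open>The eigenvector of the effective transition matrix\<close>

text \<open>With \<open>S N\<close> the partial sum, the recurrence gives \<open>S N \<le> S (N + 3) = f 0 + f 1 + f 2 + r * S N\<close>,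
which bounds \<open>S N\<close>.\<close>

lemma summable_three_step_contraction:
  fixes f :: "nat \<Rightarrow> real"
  assumes nonneg: "\<And>n. f n \<ge> 0" and r: "0 \<le> r" "r < 1" and step: "\<And>n. f (n + 3) = r * f n"
  shows "summable f"
proof (rule summableI_nonneg_bounded[OF nonneg])
  fix N
  let ?S = "\<lambda>N. \<Sum>n<N. f n"
  have "?S (N + 3) = f 0 + f 1 + f 2 + r * ?S N"
  proof (induction N)
    case 0
    then show ?case by (simp add: eval_nat_numeral)
  next
    case (Suc N)
    have "?S (Suc N + 3) = ?S (N + 3) + f (N + 3)"
      by (simp only: add_Suc sum.lessThan_Suc)
    then show ?case
      by (simp only: Suc.IH step) (simp add: algebra_simps)
  qed
  moreover have "?S N \<le> ?S (N + 3)"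
    by (rule sum_mono2) (auto intro: nonneg)
  ultimately have "(1 - r) * ?S N \<le> f 0 + f 1 + f 2"
    by (simp add: algebra_simps)
  then show "?S N \<le> (f 0 + f 1 + f 2) / (1 - r)"
    using r by (simp add: pos_le_divide_eq mult.commute)
qed

lemma mod_3_steps:
  fixes n :: nat
  shows "n mod 3 = 0 \<and> Suc n mod 3 = 1 \<and> Suc (Suc n) mod 3 = 2 \<or>
    n mod 3 = 1 \<and> Suc n mod 3 = 2 \<and> Suc (Suc n) mod 3 = 0 \<or>
    n mod 3 = 2 \<and> Suc n mod 3 = 0 \<and> Suc (Suc n) mod 3 = 1"
  by presburger

lemma normalize_rows_mult_vec:
  assumes "A \<in> carrier_mat m n" "u \<in> carrier_vec n" "i < m"
  shows "(normalize_rows A *\<^sub>v u) $ i = (\<Sum>l<n. A $$ (i, l) * u $ l) / (\<Sum>l<n. A $$ (i, l))"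
  using assms
  by (simp add: normalize_rows_def scalar_prod_def lessThan_atLeast0 sum_divide_distrib cong: sum.cong_simp)

lemma normalize_rows_const_vec:
  assumes "A \<in> carrier_mat m n" "u \<in> carrier_vec n" "i < m" "n > 0"
    and pos: "\<And>l. l < n \<Longrightarrow> A $$ (i, l) > 0" and const: "\<And>l. l < n \<Longrightarrow> u $ l = a"
  shows "(normalize_rows A *\<^sub>v u) $ i = a"
proof -
  have "(\<Sum>l<n. A $$ (i, l)) > 0"
    using pos \<open>n > 0\<close> by (intro sum_pos) auto
  then show ?thesis
    using const by (simp add: normalize_rows_mult_vec[OF assms(1-3)] flip: sum_distrib_right)
qed

definition P_weights :: "real \<Rightarrow> real \<Rightarrow> real \<Rightarrow> real mat" where
  "P_weights \<theta> Y Z = mat_of_rows_list 3 [[\<theta>^2 * Y, \<theta>, Z], [Y, \<theta>, \<theta>^2 * Z]]"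

definition Q_weights :: "real \<Rightarrow> real \<Rightarrow> real \<Rightarrow> real \<Rightarrow> real mat" where
  "Q_weights \<theta> T U N = mat_of_rows_list 4
     [[\<theta>^6 * T, \<theta>^4, \<theta>^2 * U, N], [T, 1, U, N], [T, \<theta>^2, \<theta>^4 * U, \<theta>^6 * N]]"

definition R_weights :: "real \<Rightarrow> real \<Rightarrow> real mat" where
  "R_weights \<theta> X = mat_of_rows_list 2 [[\<theta>^3, X], [\<theta>, X], [1, \<theta> * X], [1, \<theta>^3 * X]]"

lemma weights_carrier:
  "P_weights \<theta> Y Z \<in> carrier_mat 2 3" "Q_weights \<theta> T U N \<in> carrier_mat 3 4" "R_weights \<theta> X \<in> carrier_mat 4 2"
  by (auto simp: P_weights_def Q_weights_def R_weights_def mat_of_rows_list_def)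

lemma transition_matrices_normalized:
  "P_matrix \<theta> Y Z = normalize_rows (P_weights \<theta> Y Z)"
  "Q_matrix \<theta> T U N = normalize_rows (Q_weights \<theta> T U N)"
  "R_matrix \<theta> X = normalize_rows (R_weights \<theta> X)"
  by (simp_all add: P_matrix_def Q_matrix_def R_matrix_def P_weights_def Q_weights_def R_weights_def)

lemma normalize_rows_carrier: "A \<in> carrier_mat m n \<Longrightarrow> normalize_rows A \<in> carrier_mat m n"
  by (auto simp: normalize_rows_def)

lemma transition_matrices_carrier:
  "P_matrix \<theta> Y Z \<in> carrier_mat 2 3" "Q_matrix \<theta> T U N \<in> carrier_mat 3 4" "R_matrix \<theta> X \<in> carrier_mat 4 2"
  by (simp_all add: transition_matrices_normalized normalize_rows_carrier weights_carrier)

lemma weights_pos: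
  assumes "\<theta> > 0"
  shows "Y > 0 \<Longrightarrow> Z > 0 \<Longrightarrow> i < 2 \<Longrightarrow> j < 3 \<Longrightarrow> P_weights \<theta> Y Z $$ (i, j) > 0"
    and "T > 0 \<Longrightarrow> U > 0 \<Longrightarrow> N > 0 \<Longrightarrow> i < 3 \<Longrightarrow> j < 4 \<Longrightarrow> Q_weights \<theta> T U N $$ (i, j) > 0"
    and "X > 0 \<Longrightarrow> i < 4 \<Longrightarrow> j < 2 \<Longrightarrow> R_weights \<theta> X $$ (i, j) > 0"
  using assms
  by (auto simp: P_weights_def Q_weights_def R_weights_def mat_of_rows_list_def numeral_eq_Suc less_Suc_eq)

text \<open>Matrix positions of the spins, in increasing order. Spins outside the intended set get some position
in range, so that vectors read through these indices are bounded functions on all reals.\<close>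

definition psi_index :: "real \<Rightarrow> nat" where
  "psi_index s = (if s < 0 then 0 else 1)"

definition phi_index :: "real \<Rightarrow> nat" where
  "phi_index s = (if s < 0 then 0 else if s = 0 then 1 else 2)"

definition upsilon_index :: "real \<Rightarrow> nat" where
  "upsilon_index s = (if s < -1 then 0 else if s < 0 then 1 else if s < 1 then 2 else 3)"

lemma spin_index_bij:
  "bij_betw psi_index Psi_spins {..<2}"
  "bij_betw phi_index Phi_spins {..<3}"
  "bij_betw upsilon_index Upsilon_spins {..<4}"
  by (auto simp: bij_betw_def inj_on_def psi_index_def phi_index_def upsilon_index_def
      Psi_spins_def Phi_spins_def Upsilon_spins_def image_iff numeral_eq_Suc less_Suc_eq)

context splitting_measure
begin

lemma spin_set_level:
  assumes "x \<in> level G n"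
  shows "n mod 3 = 0 \<Longrightarrow> spin_set G x = Psi_spins"
    and "n mod 3 = 1 \<Longrightarrow> spin_set G x = Phi_spins"
    and "n mod 3 = 2 \<Longrightarrow> spin_set G x = Upsilon_spins"
  using assms by (auto simp: spin_set_def vertex_class_eq level_eq)

text \<open>Normalising rows makes common row factors irrelevant, so the transition law of \<open>y\<close> is a row of a
normalised matrix as soon as its \<open>branch\<close> weights are proportional to that row.\<close>

lemma transition_average:
  assumes bij: "bij_betw idx (spin_set G y) {..<n}"
    and A: "A \<in> carrier_mat m n" "u \<in> carrier_vec n" "i < m"
    and r: "r \<noteq> 0" and branch: "\<And>t. t \<in> spin_set G y \<Longrightarrow> branch y s t = r * A $$ (i, idx t)"
  shows "(\<Sum>t\<in>spin_set G y. transition y s t * u $ idx t) = (normalize_rows A *\<^sub>v u) $ i"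
proof -
  have "(\<Sum>t\<in>spin_set G y. transition y s t * u $ idx t) =
      (\<Sum>t\<in>spin_set G y. branch y s t * u $ idx t) / (\<Sum>t\<in>spin_set G y. branch y s t)"
    by (simp add: transition_def sum_divide_distrib)
  also have "\<dots> = (\<Sum>t\<in>spin_set G y. A $$ (i, idx t) * u $ idx t) / (\<Sum>t\<in>spin_set G y. A $$ (i, idx t))"
    using r by (simp add: branch mult.assoc flip: sum_distrib_left)
  also have "\<dots> = (\<Sum>l<n. A $$ (i, l) * u $ l) / (\<Sum>l<n. A $$ (i, l))"
    by (intro arg_cong2[where f = "(/)"] sum.reindex_bij_betw[OF bij])
  finally show ?thesis
    by (simp add: normalize_rows_mult_vec[OF A])
qed

context
  fixes \<theta> X Y Z T U N :: real
  assumes ratios: "has_constant_ratios G h X Y Z T U N" and \<theta>: "\<theta> = exp (\<beta> * J / 2)"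
begin

text \<open>In the three lemmas below the factor between \<open>branch\<close> weights and matrix rows is read off from one
entry of each row: the spin \<open>0\<close> for \<open>P_matrix\<close>, the spin \<open>-1/2\<close> for the other two.\<close>

lemma transition_P:
  assumes y: "y \<in> level G (Suc n)" "n mod 3 = 0" and s: "s \<in> Psi_spins" and u: "u \<in> carrier_vec 3"
  shows "(\<Sum>t\<in>spin_set G y. transition y s t * u $ phi_index t) = (P_matrix \<theta> Y Z *\<^sub>v u) $ psi_index s"
proof -
  have S: "spin_set G y = Phi_spins"
    using y(2) by (intro spin_set_level(2)[OF y(1)]) presburger
  have "y \<in> vertex_class G 1"
    using y by (simp add: vertex_class_eq level_eq) presburger
  then have YZ: "Y = exp (h y (-1) - h y 0)" "Z = exp (h y 1 - h y 0)"
    using ratios by (auto simp: has_constant_ratios_def)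
  show ?thesis
    unfolding transition_matrices_normalized
  proof (rule transition_average[where m = 2])
    show "branch y s t = exp (h y 0 - \<beta> * J / 2) * P_weights \<theta> Y Z $$ (psi_index s, phi_index t)"
      if "t \<in> spin_set G y" for t
      using that s unfolding S Psi_spins_def Phi_spins_def insert_iff empty_iff
      by (elim disjE FalseE; hypsubst; simp add: exp_of_nat_mult[symmetric] psi_index_def phi_index_def P_weights_def mat_of_rows_list_def
          branch_def YZ \<theta> mult_exp_exp algebra_simps)
  qed (use u s weights_carrier spin_index_bij in \<open>auto simp: S psi_index_def\<close>)
qed

lemma transition_Q:
  assumes y: "y \<in> level G (Suc n)" "n mod 3 = 1" and s: "s \<in> Phi_spins" and u: "u \<in> carrier_vec 4"
  shows "(\<Sum>t\<in>spin_set G y. transition y s t * u $ upsilon_index t) = (Q_matrix \<theta> T U N *\<^sub>v u) $ phi_index s"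
proof -
  have S: "spin_set G y = Upsilon_spins"
    using y(2) by (intro spin_set_level(3)[OF y(1)]) presburger
  have "y \<in> vertex_class G 2"
    using y by (simp add: vertex_class_eq level_eq) presburger
  then have TUN: "T = exp (h y (-3/2) - h y (-1/2))" "U = exp (h y (1/2) - h y (-1/2))"
      "N = exp (h y (3/2) - h y (-1/2))"
    using ratios by (auto simp: has_constant_ratios_def)
  show ?thesis
    unfolding transition_matrices_normalized
  proof (rule transition_average[where m = 3])
    show "branch y s t = exp (h y (-1/2) - 3/2 * \<beta> * J * \<bar>s\<bar>) * Q_weights \<theta> T U N $$ (phi_index s, upsilon_index t)"
      if "t \<in> spin_set G y" for t
      using that s unfolding S Phi_spins_def Upsilon_spins_def insert_iff empty_iff
      by (elim disjE FalseE; hypsubst; simp add: phi_index_def upsilon_index_def Q_weights_def mat_of_rows_list_def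
          branch_def TUN \<theta> exp_of_nat_mult[symmetric] mult_exp_exp algebra_simps)
  qed (use u s weights_carrier spin_index_bij in \<open>auto simp: S phi_index_def\<close>)
qed

lemma transition_R:
  assumes y: "y \<in> level G (Suc n)" "n mod 3 = 2" and s: "s \<in> Upsilon_spins" and u: "u \<in> carrier_vec 2"
  shows "(\<Sum>t\<in>spin_set G y. transition y s t * u $ psi_index t) = (R_matrix \<theta> X *\<^sub>v u) $ upsilon_index s"
proof -
  have S: "spin_set G y = Psi_spins"
    using y(2) by (intro spin_set_level(1)[OF y(1)]) presburger
  have "y \<in> vertex_class G 0"
    using y by (simp add: vertex_class_eq level_eq) presburger
  then have X: "X = exp (h y (1/2) - h y (-1/2))"
    using ratios by (auto simp: has_constant_ratios_def)
  show ?thesis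
    unfolding transition_matrices_normalized
  proof (rule transition_average[where m = 4])
    show "branch y s t = exp (h y (-1/2) - \<beta> * J * \<bar>s\<bar> / 2) * R_weights \<theta> X $$ (upsilon_index s, psi_index t)"
      if "t \<in> spin_set G y" for t
      using that s unfolding S Psi_spins_def Upsilon_spins_def insert_iff empty_iff
      by (elim disjE FalseE; hypsubst; simp add: exp_of_nat_mult[symmetric] psi_index_def upsilon_index_def R_weights_def mat_of_rows_list_def
          branch_def X \<theta> mult_exp_exp algebra_simps)
  qed (use u s weights_carrier spin_index_bij in \<open>auto simp: S upsilon_index_def\<close>)
qed

text \<open>The criterion for all positive constants. The eigenvector \<open>v\<close> lives on the class \<open>Psi_spins\<close>,
\<open>w = R v\<close> on \<open>Upsilon_spins\<close> and \<open>u = Q R v\<close> on \<open>Phi_spins\<close>; then \<open>P u = \<lambda> v\<close> closes the cycle,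
so the factor \<open>\<lambda>\<close> appears on the levels divisible by three.\<close>

theorem kesten_stigum:
  assumes pos: "X > 0" "Y > 0" "Z > 0" "T > 0" "U > 0" "N > 0"
    and ev: "eigenvalue (H_matrix \<theta> X Y Z T U N) lam" and lam: "lam \<noteq> 1"
    and bound: "real k ^ 3 * lam\<^sup>2 > 1"
  shows "non_extremal_gibbs G J \<beta> \<mu>"
proof -
  let ?P = "P_matrix \<theta> Y Z" and ?Q = "Q_matrix \<theta> T U N" and ?R = "R_matrix \<theta> X"
  note car = transition_matrices_carrier
  have \<theta>_pos: "\<theta> > 0" by (simp add: \<theta>)
  have H: "H_matrix \<theta> X Y Z T U N \<in> carrier_mat 2 2"
    unfolding H_matrix_def using car by (intro mult_carrier_mat)
  obtain v where v: "v \<in> carrier_vec 2" "v \<noteq> 0\<^sub>v 2" "H_matrix \<theta> X Y Z T U N *\<^sub>v v = lam \<cdot>\<^sub>v v"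
    using ev H by (auto simp: eigenvalue_def eigenvector_def)
  define w where "w = ?R *\<^sub>v v"
  define u where "u = ?Q *\<^sub>v w"
  have w: "w \<in> carrier_vec 4" and u: "u \<in> carrier_vec 3"
    unfolding u_def w_def by (rule mult_mat_vec_carrier car v)+
  have Pu: "?P *\<^sub>v u = lam \<cdot>\<^sub>v v"
  proof -
    have "H_matrix \<theta> X Y Z T U N *\<^sub>v v = (?P * ?Q) *\<^sub>v w"
      unfolding H_matrix_def w_def by (rule assoc_mult_mat_vec[OF mult_carrier_mat[OF car(1,2)] car(3) v(1)])
    also have "\<dots> = ?P *\<^sub>v u"
      unfolding u_def by (rule assoc_mult_mat_vec[OF car(1,2) w])
    finally show ?thesis
      using v by simp
  qed
  have lam0: "lam \<noteq> 0"
    using bound by auto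
  have nonconst: "v $ 0 \<noteq> v $ 1"
  proof
    assume eq: "v $ 0 = v $ 1"
    have cv: "v $ l = v $ 0" if "l < 2" for l
      using that eq by (auto simp: less_2_cases_iff)
    have cw: "w $ i = v $ 0" if "i < 4" for i
      unfolding w_def transition_matrices_normalized
      using that by (intro normalize_rows_const_vec[OF weights_carrier(3) v(1)]) (auto intro: cv weights_pos \<theta>_pos pos)
    have cu: "u $ i = v $ 0" if "i < 3" for i
      unfolding u_def transition_matrices_normalized
      using that by (intro normalize_rows_const_vec[OF weights_carrier(2) w]) (auto intro: cw weights_pos \<theta>_pos pos)
    have "(?P *\<^sub>v u) $ 0 = v $ 0"
      unfolding transition_matrices_normalized
      by (intro normalize_rows_const_vec[OF weights_carrier(1) u]) (auto intro: cu weights_pos \<theta>_pos pos)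
    then have "lam * v $ 0 = v $ 0"
      using v by (simp add: Pu)
    then have "v $ 0 = 0"
      using lam by simp
    then have "v $ l = 0" if "l < 2" for l
      using cv[OF that] by simp
    then have "v = 0\<^sub>v 2"
      using v(1) by (intro eq_vecI) auto
    then show False
      using v by simp
  qed
  define \<phi> where "\<phi> n s = (if n mod 3 = 0 then v $ psi_index s
      else if n mod 3 = 1 then u $ phi_index s else w $ upsilon_index s)" for n :: nat and s
  define c where "c n = (if n mod 3 = 0 then lam else 1)" for n :: nat
  define C where "C = (\<Sum>i<2. \<bar>v $ i\<bar>) + (\<Sum>i<3. \<bar>u $ i\<bar>) + (\<Sum>i<4. \<bar>w $ i\<bar>)"
  interpret eigenfunction_system G k J \<beta> h \<mu> \<phi> c C
  proof
    fix n y s assume y: "y \<in> level G (Suc n)" and s: "s \<in> spin_set G (parent G y)"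
    note spins = spin_set_level[OF parent_edge(2)[OF y]]
    consider "n mod 3 = 0" "Suc n mod 3 = 1" | "n mod 3 = 1" "Suc n mod 3 = 2" | "n mod 3 = 2" "Suc n mod 3 = 0"
      using mod_3_steps[of n] by metis
    then show "(\<Sum>t\<in>spin_set G y. transition y s t * \<phi> (Suc n) t) = c n * \<phi> n s"
    proof cases
      case 1
      then have "s \<in> Psi_spins" using s spins by simp
      then show ?thesis
        using transition_P[OF y 1(1) _ u, of s] v Pu 1 by (simp add: \<phi>_def c_def psi_index_def)
    next
      case 2
      then have "s \<in> Phi_spins" using s spins by simp
      then show ?thesis
        using transition_Q[OF y 2(1) _ w, of s] 2 by (simp add: \<phi>_def c_def u_def)
    next
      case 3
      then have "s \<in> Upsilon_spins" using s spins by simp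
      then show ?thesis
        using transition_R[OF y 3(1) _ v(1), of s] 3 by (simp add: \<phi>_def c_def w_def)
    qed
  next
    show "c n \<noteq> 0" for n
      using lam0 by (simp add: c_def)
    show "\<bar>\<phi> n t\<bar> \<le> C" for n t
    proof -
      have le: "\<bar>z $ i\<bar> \<le> (\<Sum>i<m. \<bar>z $ i\<bar>)" if "i < m" for z :: "real vec" and i m
        using that by (intro member_le_sum[of i "{..<m}" "\<lambda>i. \<bar>z $ i\<bar>"]) auto
      have nonneg: "0 \<le> (\<Sum>i<2. \<bar>v $ i\<bar>)" "0 \<le> (\<Sum>i<3. \<bar>u $ i\<bar>)" "0 \<le> (\<Sum>i<4. \<bar>w $ i\<bar>)"
        by (intro sum_nonneg; simp)+
      have "\<bar>v $ psi_index t\<bar> \<le> (\<Sum>i<2. \<bar>v $ i\<bar>)" "\<bar>u $ phi_index t\<bar> \<le> (\<Sum>i<3. \<bar>u $ i\<bar>)"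
          "\<bar>w $ upsilon_index t\<bar> \<le> (\<Sum>i<4. \<bar>w $ i\<bar>)"
        by (intro le; simp add: psi_index_def phi_index_def upsilon_index_def)+
      then show ?thesis
        using nonneg unfolding \<phi>_def C_def by (simp only: split: if_split) (intro conjI impI; linarith)
    qed
  qed
  have "summable (\<lambda>n. sqrt (real k ^ n) / \<bar>growth n\<bar>)"
  proof (rule summable_three_step_contraction)
    \<comment> \<open>over three levels the normalised standard deviation is multiplied by \<open>?r = 1 / sqrt (k ^ 3 * \<lambda>\<^sup>2)\<close>\<close>
    let ?r = "sqrt (real k ^ 3) / (real k ^ 3 * \<bar>lam\<bar>)"
    have k3: "real k ^ 3 > 0"
      using k_pos by simp
    show "sqrt (real k ^ (n + 3)) / \<bar>growth (n + 3)\<bar> = ?r * (sqrt (real k ^ n) / \<bar>growth n\<bar>)" for n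
    proof -
      have c3: "c n * c (Suc n) * c (Suc (Suc n)) = lam"
      proof -
        consider "n mod 3 = 0" "Suc n mod 3 = 1" "Suc (Suc n) mod 3 = 2"
          | "n mod 3 = 1" "Suc n mod 3 = 2" "Suc (Suc n) mod 3 = 0"
          | "n mod 3 = 2" "Suc n mod 3 = 0" "Suc (Suc n) mod 3 = 1"
          using mod_3_steps[of n] by metis
        then show ?thesis
          by cases (simp_all add: c_def)
      qed
      have "growth (n + 3) = growth n * (real k ^ 3 * (c n * c (Suc n) * c (Suc (Suc n))))"
        by (simp add: growth_def eval_nat_numeral)
      then have "\<bar>growth (n + 3)\<bar> = real k ^ 3 * \<bar>lam\<bar> * \<bar>growth n\<bar>"
        by (simp add: c3 abs_mult)
      then show ?thesis
        by (simp add: power_add real_sqrt_mult)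
    qed
    have "(sqrt (real k ^ 3))\<^sup>2 < (real k ^ 3 * \<bar>lam\<bar>)\<^sup>2"
    proof -
      have "real k ^ 3 * 1 < real k ^ 3 * (real k ^ 3 * lam\<^sup>2)"
        using k3 bound by (intro mult_strict_left_mono)
      also have "\<dots> = (real k ^ 3 * \<bar>lam\<bar>)\<^sup>2"
        by (simp only: power_mult_distrib power2_abs) (simp only: power2_eq_square mult_ac)
      finally show ?thesis
        by simp
    qed
    then have "sqrt (real k ^ 3) < real k ^ 3 * \<bar>lam\<bar>"
      by (rule power2_less_imp_less) simp
    then show "?r < 1"
      using k3 lam0 by simp
  qed auto
  moreover have "{-1/2, 1/2} \<subseteq> spin_set G (origin G)"
    using spin_set_level(1)[of "origin G" 0] by (simp add: level_0 Psi_spins_def)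
  moreover have "\<phi> 0 (-1/2) \<noteq> \<phi> 0 (1/2)"
    using nonconst by (simp add: \<phi>_def psi_index_def)
  ultimately show ?thesis
    by (intro non_extremal_if_summable[of "-1/2" "1/2"]) auto
qed

end

end

section \<open>The disordered phase\<close>

theorem theorem2:
  fixes G :: "'v rooted_graph" and k :: nat
    and J \<beta> \<theta> X0 Y0 Z0 T0 U0 N0 lam :: real
    and \<mu>0 :: "('v \<Rightarrow> real) measure"
  assumes "k \<ge> 1" and "J > 0" and "\<beta> > 0"
    and "\<theta> = exp (\<beta> * J / 2)"
    and "semi_infinite_cayley_tree k G"
    and "X0 = 1" and "U0 = 1"
    and "T0 = ((1 + \<theta>^3) / (\<theta>^2 + \<theta>)) ^ k" and "N0 = T0"
    and "Y0 = ((\<theta>^6 * T0 + \<theta>^4 + \<theta>^2 + T0) / (2 * \<theta>^3 * (T0 + 1))) ^ k" and "Z0 = Y0"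
    and "translation_invariant_sgm G J \<beta> X0 Y0 Z0 T0 U0 N0 \<mu>0"
    and "eigenvalue (H_matrix \<theta> X0 Y0 Z0 T0 U0 N0) lam" and "lam \<noteq> 1"
    and "real k ^ 3 * lam^2 > 1"
  shows "non_extremal_gibbs G J \<beta> \<mu>0"
proof -
  obtain h where ratios: "has_constant_ratios G h X0 Y0 Z0 T0 U0 N0"
    and sgm: "splitting_gibbs_measure G J \<beta> h \<mu>0"
    using assms(12) by (auto simp: translation_invariant_sgm_def)
  interpret splitting_measure G k J \<beta> h \<mu>0
    by unfold_locales (use assms sgm in auto)
  have \<theta>: "\<theta> > 0"
    by (simp add: assms(4))
  have T: "T0 > 0"
    unfolding assms(8) using \<theta> by (intro zero_less_power divide_pos_pos add_pos_pos) auto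
  have Y: "Y0 > 0"
    unfolding assms(10) using \<theta> T by (intro zero_less_power divide_pos_pos add_pos_pos mult_pos_pos) auto
  show ?thesis
    by (rule kesten_stigum[OF ratios assms(4) _ _ _ _ _ _ assms(13,14,15)])
      (use T Y assms(6,7,9,11) in auto)
qed

end
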